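(* Let $T\prec_{Tam} Z$ in the $s$-Tamari lattice, and let $(a_1,b_1),\dots,(a_l,b_l)$ be the Tamari tree ascents $(a_i,b_i)$ of $T$ such that $(b_i,a_i)\in\mathrm{inv}(Z)-\mathrm{inv}(T)$. Then the order complex $\Delta(T,Z)_{Tam}$ of the open interval $(T,Z)$ in the $s$-Tamari lattice is homotopy equivalent to a sphere if and only if $$\mathrm{inv}(Z)=\big(\mathrm{inv}(T)+A^{Tam}_T(a_1,b_1)+\dots+A^{Tam}_T(a_l,b_l)\big)^{tc}.$$ Moreover, in this case the dimension of the sphere is $l-2$.
   Context: A weak composition is a sequence $s=(s(1),\dots,s(n))$ of nonnegative integers. An $s$-decreasing tree is a planar rooted tree $T$ whose internal vertices are labeled bijectively by $1,\dots,n$ (leaves unlabeled), such that vertex $i$ has exactly $s(i)+1$ children indexed $0,\dots,s(i)$ from left to right, and every labeled descendant of $i$ has smaller label. $T^i_j$ is the full subtree rooted at the $j$-th child of $i$. For $1\le x<y\le n$, $\#_T(y,x)$ is: $0$ if $x$ is left of $y$ or $x\in T^y_0$; $i$ if $x\in T^y_i$ with $0<i<s(y)$; $s(y)$ if $x\in T^y_{s(y)}$ or $x$ is right of $y$. A multi-inversion set is a multiset $I$ of pairs $(y,x)$, $x<y$, with multiplicities $\#_I(y,x)$; $\mathrm{inv}(T)$ has multiplicities $\#_T(y,x)$. $I\subseteq J$ is multiplicity-wise inclusion; $J-I$ has multiplicities $\max(\#_J-\#_I,0)$; $I+J$ has multiplicities $\min(\#_I(y,x)+\#_J(y,x),s(y))$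 (an ordinary set of pairs has multiplicities $1$), $I+(b,a)=I+\{(b,a)\}$. $I$ is transitive if for all $a<b<c$ with $\#_I(c,b)=i$, either $\#_I(b,a)=0$ or $\#_I(c,a)\ge i$; $I^{tc}$ is the smallest transitive multi-inversion set containing $I$. $s$-weak order: $T\preceq Z$ iff $\mathrm{inv}(T)\subseteq\mathrm{inv}(Z)$. An $s$-Tamari tree is an $s$-decreasing tree with $\#_T(c,a)\le\#_T(c,b)$ for all $a<b<c$; these form a sublattice of $s$-weak order, the $s$-Tamari lattice (order $\preceq_{Tam}$). For $a<b$, $(a,b)$ is a Tamari tree ascent of an $s$-Tamari tree $T$ if $a$ is a child of $b$ and $\#_T(b,a)<s(b)$; the $s$-Tamari rotation of $T$ along it is the unique $s$-Tamari tree $Z'$ with $\mathrm{inv}(Z')=(\mathrm{inv}(T)+(b,a))^{tc}$, and $A^{Tam}_T(a,b)=\{(f,e):\#_{Z'}(f,e)>\#_T(f,e)\}$. *)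

theory Defs
  imports "HOL-Analysis.Analysis" "HOL-Library.Multiset"
begin

section \<open>Decreasing trees of a weak composition\<close>

text \<open>
  A weak composition \<open>(s(1), \<dots>, s(n))\<close> is given by its length \<open>n\<close> and a function
  \<open>s :: nat \<Rightarrow> nat\<close>, of which only the values on \<open>{1..n}\<close> matter.
\<close>

datatype ptree = Leaf | Node nat "ptree list"

primrec labels :: "ptree \<Rightarrow> nat list" where
  "labels Leaf = []"
| "labels (Node x ts) = x # concat (map labels ts)"

primrec subtrees :: "ptree \<Rightarrow> ptree set" where
  "subtrees Leaf = {Leaf}"
| "subtrees (Node x ts) = insert (Node x ts) (\<Union> (set (map subtrees ts)))"

definition decreasing_tree :: "nat \<Rightarrow> (nat \<Rightarrow> nat) \<Rightarrow> ptree \<Rightarrow> bool" where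
  "decreasing_tree n s T \<longleftrightarrow>
     distinct (labels T) \<and> set (labels T) = {1..n} \<and>
     (\<forall>x ts. Node x ts \<in> subtrees T \<longrightarrow>
        length ts = s x + 1 \<and> (\<forall>t\<in>set ts. \<forall>y\<in>set (labels t). y < x))"

text \<open>\<open>in_branch T y j x\<close>: the vertex \<open>x\<close> lies in the full subtree \<open>T\<^sup>y\<^sub>j\<close> rooted at the
  \<open>j\<close>-th child of \<open>y\<close>.\<close>

definition in_branch :: "ptree \<Rightarrow> nat \<Rightarrow> nat \<Rightarrow> nat \<Rightarrow> bool" where
  "in_branch T y j x \<longleftrightarrow>
     (\<exists>ts. Node y ts \<in> subtrees T \<and> j < length ts \<and> x \<in> set (labels (ts ! j)))"

definition child_of :: "ptree \<Rightarrow> nat \<Rightarrow> nat \<Rightarrow> bool" where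
  "child_of T a b \<longleftrightarrow> (\<exists>ts us. Node b ts \<in> subtrees T \<and> Node a us \<in> set ts)"

definition left_of :: "ptree \<Rightarrow> nat \<Rightarrow> nat \<Rightarrow> bool" where
  "left_of T x y \<longleftrightarrow> (\<exists>z i j. in_branch T z i x \<and> in_branch T z j y \<and> i < j)"

definition tree_mult :: "(nat \<Rightarrow> nat) \<Rightarrow> ptree \<Rightarrow> nat \<Rightarrow> nat \<Rightarrow> nat" where
  "tree_mult s T y x =
     (if left_of T x y \<or> in_branch T y 0 x then 0
      else if in_branch T y (s y) x \<or> left_of T y x then s y
      else (THE i. 0 < i \<and> i < s y \<and> in_branch T y i x))"


section \<open>Multi-inversion sets\<close>

text \<open>Multi-inversion sets are finite multisets of pairs \<open>(y, x)\<close> with \<open>1 \<le> x < y \<le> n\<close>,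
  the larger entry first. Inclusion and difference are \<open>\<subseteq>#\<close> and \<open>-\<close> of the library.\<close>

definition inversion_pairs :: "nat \<Rightarrow> (nat \<times> nat) set" where
  "inversion_pairs n = {(y, x). 1 \<le> x \<and> x < y \<and> y \<le> n}"

definition multi_inversion_set :: "nat \<Rightarrow> (nat \<times> nat) multiset \<Rightarrow> bool" where
  "multi_inversion_set n I \<longleftrightarrow> set_mset I \<subseteq> inversion_pairs n"

definition tree_inv :: "nat \<Rightarrow> (nat \<Rightarrow> nat) \<Rightarrow> ptree \<Rightarrow> (nat \<times> nat) multiset" where
  "tree_inv n s T =
     (\<Sum>p\<in>inversion_pairs n. replicate_mset (tree_mult s T (fst p) (snd p)) p)"

definition capped_add ::
    "(nat \<Rightarrow> nat) \<Rightarrow> (nat \<times> nat) multiset \<Rightarrow> (nat \<times> nat) multiset \<Rightarrow> (nat \<times> nat) multiset" where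
  "capped_add s I J =
     (\<Sum>p\<in>set_mset (I + J). replicate_mset (min (count I p + count J p) (s (fst p))) p)"

definition transitive_mis :: "nat \<Rightarrow> (nat \<times> nat) multiset \<Rightarrow> bool" where
  "transitive_mis n I \<longleftrightarrow> multi_inversion_set n I \<and>
     (\<forall>a b c. 1 \<le> a \<and> a < b \<and> b < c \<and> c \<le> n \<longrightarrow>
        count I (b, a) = 0 \<or> count I (c, b) \<le> count I (c, a))"

definition trans_closure :: "nat \<Rightarrow> (nat \<times> nat) multiset \<Rightarrow> (nat \<times> nat) multiset" where
  "trans_closure n I =
     (THE J. transitive_mis n J \<and> I \<subseteq># J \<and> (\<forall>K. transitive_mis n K \<and> I \<subseteq># K \<longrightarrow> J \<subseteq># K))"

lemma finite_inversion_pairs: "finite (inversion_pairs n)"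
  by (rule finite_subset[of _ "{..n} \<times> {..n}"]) (auto simp: inversion_pairs_def)

lemma count_sum_replicate_mset:
  "finite A \<Longrightarrow> count (\<Sum>p\<in>A. replicate_mset (f p) p) q = (if q \<in> A then f q else 0)"
  by (simp add: count_sum sum.delta)

lemma count_tree_inv:
  assumes "1 \<le> x" "x < y" "y \<le> n"
  shows "count (tree_inv n s T) (y, x) = tree_mult s T y x"
  using assms
  by (simp add: tree_inv_def count_sum_replicate_mset finite_inversion_pairs)
    (simp add: inversion_pairs_def)

lemma count_capped_add:
  "count (capped_add s I J) (y, x) = min (count I (y, x) + count J (y, x)) (s y)"
  by (auto simp: capped_add_def count_sum_replicate_mset not_in_iff)

text \<open>The description in \<open>trans_closure\<close> determines a unique multiset.\<close>

lemma trans_closure_ex1: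
  assumes "multi_inversion_set n I"
  shows "\<exists>!J. transitive_mis n J \<and> I \<subseteq># J \<and>
           (\<forall>K. transitive_mis n K \<and> I \<subseteq># K \<longrightarrow> J \<subseteq># K)"
proof -
  define \<K> where "\<K> = {K. transitive_mis n K \<and> I \<subseteq># K}"
  define M where "M = (\<Sum>p\<in>inversion_pairs n. replicate_mset (size I) p)"
  have cM: "count M p = (if p \<in> inversion_pairs n then size I else 0)" for p
    by (simp add: M_def count_sum_replicate_mset finite_inversion_pairs)
  have "I \<subseteq># M"
  proof (rule mset_subset_eqI)
    fix p
    show "count I p \<le> count M p"
      using assms count_le_size[of I p]
      by (auto simp: cM multi_inversion_set_def not_in_iff[symmetric])
  qed
  moreover have "set_mset M \<subseteq> inversion_pairs n"
  proof
    fix p assume "p \<in># M"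
    then have "count M p \<noteq> 0" by simp
    then show "p \<in> inversion_pairs n" by (simp add: cM split: if_splits)
  qed
  moreover have "count M (c, b) \<le> count M (c, a)"
    if "1 \<le> a" "a < b" "b < c" "c \<le> n" for a b c
    using that by (simp add: cM inversion_pairs_def)
  ultimately have "M \<in> \<K>"
    by (auto simp: \<K>_def transitive_mis_def multi_inversion_set_def)
  then have ne: "\<K> \<noteq> {}" by auto
  define J where "J = Inf \<K>"
  have lower: "J \<subseteq># K" if "K \<in> \<K>" for K
    unfolding J_def using that by (rule subset_mset.cInf_lower) simp
  have "I \<subseteq># J"
    unfolding J_def using ne by (rule subset_mset.cInf_greatest) (simp add: \<K>_def)
  moreover have "transitive_mis n J"
    unfolding transitive_mis_def
  proof (intro conjI allI impI)
    show "multi_inversion_set n J"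
      using lower[OF \<open>M \<in> \<K>\<close>] \<open>set_mset M \<subseteq> _\<close>
      by (auto simp: multi_inversion_set_def dest: mset_subset_eqD)
    fix a b c assume abc: "1 \<le> a \<and> a < b \<and> b < c \<and> c \<le> n"
    then have closed: "count K (b, a) = 0 \<or> count K (c, b) \<le> count K (c, a)" if "K \<in> \<K>" for K
      using that by (simp add: \<K>_def transitive_mis_def)
    show "count J (b, a) = 0 \<or> count J (c, b) \<le> count J (c, a)"
    proof (cases "count J (b, a) = 0")
      case False
      obtain K where K: "K \<in> \<K>" "count J (c, a) = count K (c, a)"
        using Inf_nat_def1[of "(\<lambda>X. count X (c, a)) ` \<K>"] ne
        by (auto simp: J_def count_Inf_multiset_nonempty[OF ne])
      have "count K (b, a) \<noteq> 0"
        using False mset_subset_eqD[OF lower[OF K(1)], of "(b, a)"]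
        by (auto simp: count_eq_zero_iff)
      then have "count K (c, b) \<le> count K (c, a)"
        using closed[OF K(1)] by (simp add: count_eq_zero_iff)
      then show ?thesis
        using mset_subset_eq_count[OF lower[OF K(1)], of "(c, b)"] K(2) by simp
    qed simp
  qed
  ultimately show ?thesis
    using lower by (intro ex1I[of _ J]) (simp_all add: \<K>_def subset_mset.antisym)
qed


section \<open>The Tamari lattice of a weak composition\<close>

definition tamari_tree :: "nat \<Rightarrow> (nat \<Rightarrow> nat) \<Rightarrow> ptree \<Rightarrow> bool" where
  "tamari_tree n s T \<longleftrightarrow> decreasing_tree n s T \<and>
     (\<forall>a b c. 1 \<le> a \<and> a < b \<and> b < c \<and> c \<le> n \<longrightarrow> tree_mult s T c a \<le> tree_mult s T c b)"

definition tamari_le :: "nat \<Rightarrow> (nat \<Rightarrow> nat) \<Rightarrow> ptree \<Rightarrow> ptree \<Rightarrow> bool" where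
  "tamari_le n s T Z \<longleftrightarrow>
     tamari_tree n s T \<and> tamari_tree n s Z \<and> tree_inv n s T \<subseteq># tree_inv n s Z"

definition tamari_less :: "nat \<Rightarrow> (nat \<Rightarrow> nat) \<Rightarrow> ptree \<Rightarrow> ptree \<Rightarrow> bool" where
  "tamari_less n s T Z \<longleftrightarrow> tamari_le n s T Z \<and> T \<noteq> Z"

definition tamari_ascent :: "(nat \<Rightarrow> nat) \<Rightarrow> ptree \<Rightarrow> nat \<Rightarrow> nat \<Rightarrow> bool" where
  "tamari_ascent s T a b \<longleftrightarrow> a < b \<and> child_of T a b \<and> tree_mult s T b a < s b"

definition tamari_rotation :: "nat \<Rightarrow> (nat \<Rightarrow> nat) \<Rightarrow> ptree \<Rightarrow> nat \<Rightarrow> nat \<Rightarrow> ptree" where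
  "tamari_rotation n s T a b =
     (THE Z'. tamari_tree n s Z' \<and>
        tree_inv n s Z' = trans_closure n (capped_add s (tree_inv n s T) {#(b, a)#}))"

definition tamari_added :: "nat \<Rightarrow> (nat \<Rightarrow> nat) \<Rightarrow> ptree \<Rightarrow> nat \<Rightarrow> nat \<Rightarrow> (nat \<times> nat) set" where
  "tamari_added n s T a b =
     {p. count (tree_inv n s T) p < count (tree_inv n s (tamari_rotation n s T a b)) p}"

definition tamari_open_interval :: "nat \<Rightarrow> (nat \<Rightarrow> nat) \<Rightarrow> ptree \<Rightarrow> ptree \<Rightarrow> ptree set" where
  "tamari_open_interval n s T Z = {W. tamari_less n s T W \<and> tamari_less n s W Z}"


section \<open>Order complexes and spheres\<close>

definition order_complex :: "('a \<Rightarrow> 'a \<Rightarrow> bool) \<Rightarrow> 'a set \<Rightarrow> 'a set set" where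
  "order_complex le P =
     {C. C \<subseteq> P \<and> finite C \<and> C \<noteq> {} \<and> Complete_Partial_Order.chain le C}"

text \<open>Geometric realization of an abstract simplicial complex, in barycentric coordinates.
  For complexes with finitely many vertices (the only ones needed here) the product topology
  is the usual one. The complex without nonempty faces is realized by the empty space.\<close>

definition geometric_realization :: "'a set set \<Rightarrow> ('a \<Rightarrow> real) topology" where
  "geometric_realization K =
     subtopology (powertop_real UNIV)
       {f. (\<forall>v. 0 \<le> f v) \<and> {v. f v \<noteq> 0} \<in> K \<and> (\<Sum>v | f v \<noteq> 0. f v) = 1}"

definition tamari_order_complex ::
    "nat \<Rightarrow> (nat \<Rightarrow> nat) \<Rightarrow> ptree \<Rightarrow> ptree \<Rightarrow> (ptree \<Rightarrow> real) topology" where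
  "tamari_order_complex n s T Z =
     geometric_realization (order_complex (tamari_le n s) (tamari_open_interval n s T Z))"

text \<open>The sphere of dimension \<open>d \<ge> -1\<close>; the \<open>(-1)\<close>-dimensional sphere is the empty space, which
  is the order complex of the open interval of a cover relation.\<close>

definition sphere_space :: "int \<Rightarrow> (nat \<Rightarrow> real) topology" where
  "sphere_space d = (if d = -1 then trivial_topology else nsphere (nat d))"

end

theory Submission
  imports Defs "HOL-Homology.Brouwer_Degree"
begin

text \<open>
  Inversion sets of \<open>s\<close>-Tamari trees are exactly the transitive multi-inversion sets bounded by
  \<open>s\<close> whose rows are monotone. They are closed under intersection, every element strictly above
  \<open>T\<close> lies above some rotation of \<open>T\<close>, and the join of a set of rotations of \<open>T\<close> lies above no
  other rotation. Sending \<open>W\<close> to the join of the rotations below \<open>W\<close> is a descending order-preserving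
  map, so the order complex of \<open>(T, Z)\<close> retracts up to homotopy to the joins of nonempty sets of
  rotations other than \<open>Z\<close>. If the join of all rotations below \<open>Z\<close> is not \<open>Z\<close>, this poset has a
  maximum and the complex is contractible. Otherwise it is the poset of nonempty proper subsets of an
  \<open>l\<close>-element set, whose order complex is the barycentric subdivision of the boundary of a simplex.
\<close>


section \<open>Tamari multi-inversion sets\<close>

text \<open>Lying above a rotation is a condition on a single entry: a transitive set containing
  \<open>I\<close> contains the rotation along \<open>(a, b)\<close> as soon as its count at
  \<open>(b, a)\<close> exceeds that of \<open>I\<close>. Joins of rotations are therefore
  intersections of the Tamari sets that satisfy one strict inequality per rotation. The
  combinatorial obstacle is that the closure in the theorem is taken among all transitive sets, with
  or without monotone rows. The closure of the capped sum has to be shown to keep monotone rows; the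
  cap itself never acts, because the added sets are pairwise disjoint and their entries lie below
  the cap. On the topological side the homotopies are explicit formulas in barycentric coordinates.
  The sphere arises as the nonconstant vectors of length \<open>l\<close> modulo translation and
  positive scaling, which costs two dimensions and gives \<open>l - 2\<close>. At least one ascent
  always exists, and a single one gives the empty sphere of dimension -1 in the spherical case.
  Reduced homology separates the spheres from each other.\<close>

declare count_greater_zero_iff [simp del] count_greater_eq_Suc_zero_iff [simp del]
  count_greater_eq_one_iff [simp del]

definition mis_of :: "nat \<Rightarrow> (nat \<Rightarrow> nat \<Rightarrow> nat) \<Rightarrow> (nat \<times> nat) multiset" where
  "mis_of n f = (\<Sum>p\<in>inversion_pairs n. replicate_mset (f (fst p) (snd p)) p)"

lemma count_mis_of:
  "count (mis_of n f) (y, x) = (if 1 \<le> x \<and> x < y \<and> y \<le> n then f y x else 0)"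
  unfolding mis_of_def
  by (subst count_sum_replicate_mset[OF finite_inversion_pairs]) (auto simp: inversion_pairs_def)

lemma tree_inv_eq: "tree_inv n s T = mis_of n (tree_mult s T)"
  by (simp add: tree_inv_def mis_of_def)

lemma multi_inversion_set_iff:
  "multi_inversion_set n I \<longleftrightarrow> (\<forall>y x. 0 < count I (y, x) \<longrightarrow> 1 \<le> x \<and> x < y \<and> y \<le> n)"
  by (auto simp: multi_inversion_set_def inversion_pairs_def count_greater_zero_iff)

lemma multi_inversion_set_mis_of: "multi_inversion_set n (mis_of n f)"
  by (auto simp: multi_inversion_set_iff count_mis_of split: if_splits)

lemma mis_subset_iff:
  assumes "multi_inversion_set n I"
  shows "I \<subseteq># J \<longleftrightarrow> (\<forall>y x. 1 \<le> x \<and> x < y \<and> y \<le> n \<longrightarrow> count I (y, x) \<le> count J (y, x))"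
  using assms unfolding multi_inversion_set_iff subseteq_mset_def
  by (metis bot_nat_0.extremum not_gr_zero surj_pair)

definition monotone_mis :: "nat \<Rightarrow> (nat \<times> nat) multiset \<Rightarrow> bool" where
  "monotone_mis n I \<longleftrightarrow>
     (\<forall>a b c. 1 \<le> a \<and> a < b \<and> b < c \<and> c \<le> n \<longrightarrow> count I (c, a) \<le> count I (c, b))"

definition tamari_mis :: "nat \<Rightarrow> (nat \<Rightarrow> nat) \<Rightarrow> (nat \<times> nat) multiset \<Rightarrow> bool" where
  "tamari_mis n s I \<longleftrightarrow>
     transitive_mis n I \<and> monotone_mis n I \<and> (\<forall>y x. count I (y, x) \<le> s y)"

text \<open>The last clause is the form in which transitivity is used later: transitivity gives one
  inequality between the entries of row \<open>c\<close> at \<open>a\<close> and \<open>b\<close>,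
  row monotonicity the other, so an inversion \<open>(b, a)\<close> makes every higher row agree at
  \<open>a\<close> and \<open>b\<close>.\<close>

lemma tamari_misD:
  assumes "tamari_mis n s I"
  shows "multi_inversion_set n I" "transitive_mis n I" "monotone_mis n I" "count I (y, x) \<le> s y"
    and "0 < count I (y, x) \<Longrightarrow> 1 \<le> x \<and> x < y \<and> y \<le> n"
    and "\<lbrakk>1 \<le> a; a < b; b < c; c \<le> n\<rbrakk> \<Longrightarrow> count I (c, a) \<le> count I (c, b)"
    and "\<lbrakk>1 \<le> a; a < b; b < c; c \<le> n; 0 < count I (b, a)\<rbrakk> \<Longrightarrow> count I (c, a) = count I (c, b)"
proof -
  show 1: "multi_inversion_set n I" "transitive_mis n I" "monotone_mis n I" "count I (y, x) \<le> s y"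
    using assms by (auto simp: tamari_mis_def transitive_mis_def)
  show "0 < count I (y, x) \<Longrightarrow> 1 \<le> x \<and> x < y \<and> y \<le> n"
    using 1(1) by (simp add: multi_inversion_set_iff)
  show 2: "count I (c, a) \<le> count I (c, b)" if "1 \<le> a" "a < b" "b < c" "c \<le> n" for a b c
    using 1(3) that by (auto simp: monotone_mis_def)
  show "count I (c, a) = count I (c, b)"
    if h: "1 \<le> a" "a < b" "b < c" "c \<le> n" "0 < count I (b, a)"
  proof -
    have "count I (b, a) = 0 \<or> count I (c, b) \<le> count I (c, a)"
      using 1(2) h unfolding transitive_mis_def by blast
    then show ?thesis using 2[OF h(1-4)] h(5) by simp
  qed
qed

lemma tamari_mis_of:
  assumes "\<And>y x. \<lbrakk>1 \<le> x; x < y; y \<le> n\<rbrakk> \<Longrightarrow> f y x \<le> s y"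
    and "\<And>a b c. \<lbrakk>1 \<le> a; a < b; b < c; c \<le> n\<rbrakk> \<Longrightarrow> f c a \<le> f c b"
    and "\<And>a b c. \<lbrakk>1 \<le> a; a < b; b < c; c \<le> n; 0 < f b a\<rbrakk> \<Longrightarrow> f c b \<le> f c a"
  shows "tamari_mis n s (mis_of n f)"
proof -
  have "transitive_mis n (mis_of n f)"
    unfolding transitive_mis_def count_mis_of
    using multi_inversion_set_mis_of[of n f] assms(3) by auto
  then show ?thesis
    using assms(1,2) by (simp add: tamari_mis_def monotone_mis_def count_mis_of)
qed

lemma trans_closureD:
  assumes "multi_inversion_set n I"
  shows "transitive_mis n (trans_closure n I)" "I \<subseteq># trans_closure n I"
    and "\<lbrakk>transitive_mis n K; I \<subseteq># K\<rbrakk> \<Longrightarrow> trans_closure n I \<subseteq># K"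
  using theI'[OF trans_closure_ex1[OF assms]] unfolding trans_closure_def by blast+

lemma trans_closure_eqI:
  assumes "transitive_mis n J" "I \<subseteq># J"
    and "\<And>K. \<lbrakk>transitive_mis n K; I \<subseteq># K\<rbrakk> \<Longrightarrow> J \<subseteq># K"
  shows "trans_closure n I = J"
  unfolding trans_closure_def
  using assms by (intro the_equality) (auto intro: subset_mset.antisym)

text \<open>The least monotone minorant of the transitive closure is still transitive and still
  contains \<open>I\<close>, so it is the transitive closure.\<close>

lemma monotone_trans_closure:
  assumes I: "multi_inversion_set n I" "monotone_mis n I"
  shows "monotone_mis n (trans_closure n I)"
proof -
  define J where "J = trans_closure n I"
  note J = trans_closureD[OF I(1), folded J_def]
  define f where "f = (\<lambda>c a. Min ((\<lambda>x. count J (c, x)) ` {a..<c}))"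
  define M where "M = mis_of n f"
  have cM: "count M (c, a) = f c a" if "1 \<le> a" "a < c" "c \<le> n" for a c
    using that by (simp add: M_def count_mis_of)
  have le_f: "k \<le> f c a \<longleftrightarrow> (\<forall>x. a \<le> x \<and> x < c \<longrightarrow> k \<le> count J (c, x))" if "a < c" for a c k
    using that by (auto simp: f_def)
  have f_le: "f c a \<le> count J (c, x)" if "a \<le> x" "x < c" for a c x
    using le_f[of a c "f c a"] that by auto
  have "M \<subseteq># J"
    unfolding M_def mis_subset_iff[OF multi_inversion_set_mis_of] by (auto simp: count_mis_of f_le)
  moreover have "I \<subseteq># M"
    unfolding mis_subset_iff[OF I(1)]
  proof (intro allI impI)
    fix c a assume a: "1 \<le> a \<and> a < c \<and> c \<le> n"
    have "count I (c, a) \<le> count J (c, x)" if "a \<le> x" "x < c" for x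
    proof -
      have "count I (c, a) \<le> count I (c, x)"
        using I(2) a that unfolding monotone_mis_def by (cases "a = x") auto
      also have "\<dots> \<le> count J (c, x)" using J(2) by (rule mset_subset_eq_count)
      finally show ?thesis .
    qed
    then show "count I (c, a) \<le> count M (c, a)"
      using a by (simp add: cM le_f)
  qed
  moreover have "transitive_mis n M"
    unfolding transitive_mis_def
  proof (intro conjI allI impI)
    show "multi_inversion_set n M" by (simp add: M_def multi_inversion_set_mis_of)
    fix a b c assume abc: "1 \<le> a \<and> a < b \<and> b < c \<and> c \<le> n"
    show "count M (b, a) = 0 \<or> count M (c, b) \<le> count M (c, a)"
    proof (cases "count M (b, a) = 0")
      case False
      \<comment> \<open>A nonzero minimum over a row segment makes every entry of the segment
        nonzero, so transitivity of \<open>J\<close> is available at each \<open>x\<close> of the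
        segment and not only at \<open>a\<close>.\<close>
      then have pos: "0 < count J (b, x)" if "a \<le> x" "x < b" for x
        using f_le[OF that] abc by (simp add: cM)
      have "f c b \<le> count J (c, x)" if "a \<le> x" "x < c" for x
      proof (cases "x < b")
        case True
        then have "count J (c, b) \<le> count J (c, x)"
          using J(1) pos[OF that(1) True] abc that unfolding transitive_mis_def
          by (metis less_irrefl order_trans)
        then show ?thesis using f_le[of b b c] abc by simp
      qed (use that f_le in auto)
      then show ?thesis using abc by (simp add: cM le_f)
    qed simp
  qed
  ultimately have "M = J"
    using J(3) by (simp add: subset_mset.antisym)
  show ?thesis
    unfolding monotone_mis_def J_def[symmetric] \<open>M = J\<close>[symmetric]
  proof (intro allI impI)
    fix a b c assume abc: "1 \<le> a \<and> a < b \<and> b < c \<and> c \<le> n"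
    then show "count M (c, a) \<le> count M (c, b)" by (auto simp: cM le_f f_le)
  qed
qed

section \<open>Ascents and rotations of multi-inversion sets\<close>

text \<open>The child relation read off the counts: agreement in all higher rows says that no larger
  vertex separates \<open>a\<close> from \<open>b\<close>, and the strict increase to the right of
  \<open>a\<close> in row \<open>b\<close> says that \<open>a\<close> is the largest label in its
  branch of \<open>b\<close>.\<close>

definition mis_ascent ::
    "nat \<Rightarrow> (nat \<Rightarrow> nat) \<Rightarrow> (nat \<times> nat) multiset \<Rightarrow> nat \<Rightarrow> nat \<Rightarrow> bool" where
  "mis_ascent n s I a b \<longleftrightarrow> 1 \<le> a \<and> a < b \<and> b \<le> n \<and> count I (b, a) < s b \<and>
     (\<forall>c. b < c \<and> c \<le> n \<longrightarrow> count I (c, a) = count I (c, b)) \<and>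
     (\<forall>e. a < e \<and> e < b \<longrightarrow> count I (b, a) < count I (b, e))"

text \<open>Raising \<open>(b, a)\<close> forces, by transitivity through \<open>(a, e)\<close>,
  that every \<open>(b, e)\<close> with an inversion \<open>(a, e)\<close> be raised too. These
  pairs turn out to suffice.\<close>

definition mis_added :: "(nat \<times> nat) multiset \<Rightarrow> nat \<Rightarrow> nat \<Rightarrow> (nat \<times> nat) set" where
  "mis_added I a b = insert (b, a) {(b, e) | e. 0 < count I (a, e)}"

definition mis_rotation :: "nat \<Rightarrow> (nat \<times> nat) multiset \<Rightarrow> nat \<Rightarrow> nat \<Rightarrow> (nat \<times> nat) multiset" where
  "mis_rotation n I a b =
     mis_of n (\<lambda>y x. count I (y, x) + (if (y, x) \<in> mis_added I a b then 1 else 0))"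

lemma mis_ascentD:
  assumes "mis_ascent n s I a b"
  shows "1 \<le> a" "a < b" "b \<le> n" "count I (b, a) < s b"
    "\<lbrakk>b < c; c \<le> n\<rbrakk> \<Longrightarrow> count I (c, a) = count I (c, b)"
    "\<lbrakk>a < e; e < b\<rbrakk> \<Longrightarrow> count I (b, a) < count I (b, e)"
  using assms by (auto simp: mis_ascent_def)

text \<open>For \<open>x < a\<close> the pair \<open>(a, x)\<close> is an inversion, which equates
  the entries of row \<open>b\<close> at \<open>x\<close> and \<open>a\<close>. So a rotation raises
  entries of one common value, which lies below \<open>s b\<close>.\<close>

lemma mis_addedD:
  assumes "tamari_mis n s I" "mis_ascent n s I a b" "(y, x) \<in> mis_added I a b"
  shows "y = b" "1 \<le> x" "x \<le> a" "count I (b, x) = count I (b, a)" "x = a \<or> 0 < count I (a, x)"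
proof -
  show y: "y = b" and *: "x = a \<or> 0 < count I (a, x)"
    using assms(3) by (auto simp: mis_added_def)
  show "1 \<le> x" "x \<le> a"
    using * mis_ascentD[OF assms(2)] tamari_misD(5)[OF assms(1), of a x] by auto
  with * show "count I (b, x) = count I (b, a)"
    using mis_ascentD[OF assms(2)] tamari_misD(7)[OF assms(1), of x a b]
    by (cases "x = a") auto
qed

lemma finite_mis_added:
  assumes "tamari_mis n s I"
  shows "finite (mis_added I a b)"
proof -
  have "mis_added I a b \<subseteq> {b} \<times> {..a}"
  proof
    fix p assume "p \<in> mis_added I a b"
    then obtain e where "p = (b, e)" "e = a \<or> 0 < count I (a, e)" by (auto simp: mis_added_def)
    then show "p \<in> {b} \<times> {..a}" using tamari_misD(5)[OF assms, of a e] by auto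
  qed
  then show ?thesis by (rule finite_subset) simp
qed

lemma count_mis_rotation:
  assumes "tamari_mis n s I" "mis_ascent n s I a b"
  shows "count (mis_rotation n I a b) (y, x) =
    count I (y, x) + (if (y, x) \<in> mis_added I a b then 1 else 0)"
  using tamari_misD(5)[OF assms(1), of y x] mis_addedD[OF assms, of y x] mis_ascentD(1-3)[OF assms(2)]
  by (auto simp: mis_rotation_def count_mis_of)

text \<open>Monotonicity could fail only between a raised \<open>x\<close> and an unraised
  \<open>y\<close> of row \<open>b\<close>. If \<open>a < y\<close>, the ascent leaves a strict gap;
  if \<open>y < a\<close>, row \<open>a\<close> is positive at \<open>x\<close>, hence at
  \<open>y\<close>, and \<open>y\<close> is raised after all. For transitivity, an old inversion
  \<open>(y, x)\<close> carries raising from \<open>y\<close> to \<open>x\<close>, and a new one has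
  \<open>y = b\<close>, where the higher rows agree at \<open>a\<close> and \<open>b\<close> by the
  ascent condition.\<close>

lemma tamari_mis_rotation:
  assumes I: "tamari_mis n s I" and ab: "mis_ascent n s I a b"
  shows "tamari_mis n s (mis_rotation n I a b)"
  unfolding mis_rotation_def
proof (rule tamari_mis_of)
  let ?A = "mis_added I a b"
  note A = mis_addedD[OF I ab]
  note asc = mis_ascentD[OF ab]
  note tam = tamari_misD[OF I]
  show "count I (y, x) + (if (y, x) \<in> ?A then 1 else 0) \<le> s y"
    if "1 \<le> x" "x < y" "y \<le> n" for y x
    using A[of y x] tam(4)[of y x] asc(4) by auto
  show "count I (c, x) + (if (c, x) \<in> ?A then 1 else 0)
      \<le> count I (c, y) + (if (c, y) \<in> ?A then 1 else 0)"
    if "1 \<le> x" "x < y" "y < c" "c \<le> n" for x y c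
  proof (cases "(c, x) \<in> ?A \<and> (c, y) \<notin> ?A")
    case True
    then have c: "c = b" and x: "count I (b, x) = count I (b, a)" "x = a \<or> 0 < count I (a, x)"
      "x \<le> a" using A[of c x] by auto
    have "count I (b, a) < count I (b, y)"
    proof (cases "a < y")
      case True
      then show ?thesis using asc(6) that c by auto
    next
      case False
      then have "y < a" using True c by (cases "y = a") (auto simp: mis_added_def)
      then have "0 < count I (a, y)"
        using x(2) tam(6)[of x y a] that asc by auto
      then show ?thesis using True c by (auto simp: mis_added_def)
    qed
    then show ?thesis using True c x by auto
  next
    case False
    then show ?thesis using tam(6)[OF that] by auto
  qed
  show "count I (c, y) + (if (c, y) \<in> ?A then 1 else 0)
      \<le> count I (c, x) + (if (c, x) \<in> ?A then 1 else 0)"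
    if h: "1 \<le> x" "x < y" "y < c" "c \<le> n" "0 < count I (y, x) + (if (y, x) \<in> ?A then 1 else 0)"
    for x y c
  proof (cases "0 < count I (y, x)")
    case True
    have "(c, x) \<in> ?A" if "(c, y) \<in> ?A"
      using A[OF that] True tam(7)[of x y a] h asc(2,3)
      by (cases "y = a") (auto simp: mis_added_def)
    then show ?thesis using tam(7)[OF h(1-4) True] by auto
  next
    case False
    then have mem: "(y, x) \<in> ?A" using h(5) by (auto split: if_splits)
    note yx = A[OF mem]
    have "(c, y) \<notin> ?A" using A(1)[of c y] yx(1) h by auto
    moreover have "count I (c, a) = count I (c, b)" using asc(5) h yx(1) by auto
    moreover have "count I (c, x) = count I (c, a)"
      using tam(7)[of x a c] yx asc h by (cases "x = a") auto
    ultimately show ?thesis using yx(1) by simp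
  qed
qed

text \<open>Transitivity of \<open>K\<close> through the inversions \<open>(a, x)\<close> spreads
  the increase at \<open>(b, a)\<close> to all raised entries. \<open>K\<close> is only assumed
  transitive, since the closure defining a rotation competes with all transitive sets.\<close>

lemma mis_rotation_subset:
  assumes I: "tamari_mis n s I" and ab: "mis_ascent n s I a b"
    and K: "transitive_mis n K" "I \<subseteq># K" "count I (b, a) < count K (b, a)"
  shows "mis_rotation n I a b \<subseteq># K"
  unfolding subseteq_mset_def
proof (clarify)
  fix y x
  note A = mis_addedD[OF I ab, of y x]
  note asc = mis_ascentD[OF ab]
  have le: "count I p \<le> count K p" for p using K(2) by (rule mset_subset_eq_count)
  have "count I (b, x) < count K (b, x)" if "(y, x) \<in> mis_added I a b"
  proof (cases "x = a")
    case False
    then have "0 < count I (a, x)" using A that by auto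
    then have "0 < count K (a, x)" using le[of "(a, x)"] by simp
    then have "count K (b, a) \<le> count K (b, x)"
      using K(1) A that False asc unfolding transitive_mis_def
      by (metis le_neq_implies_less less_irrefl)
    then show ?thesis using K(3) A that by simp
  qed (use K in simp)
  then show "count (mis_rotation n I a b) (y, x) \<le> count K (y, x)"
    using le[of "(y, x)"] A(1) by (auto simp: count_mis_rotation[OF I ab])
qed

lemma mis_rotation_eq_trans_closure:
  assumes I: "tamari_mis n s I" and ab: "mis_ascent n s I a b"
  shows "trans_closure n (capped_add s I {#(b, a)#}) = mis_rotation n I a b"
proof (rule trans_closure_eqI)
  note tam = tamari_misD[OF I]
  have c: "count (capped_add s I {#(b, a)#}) (y, x) = count I (y, x) + (if (y, x) = (b, a) then 1 else 0)"
    for y x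
    using tam(4)[of y x] mis_ascentD(4)[OF ab] by (auto simp: count_capped_add)
  show "transitive_mis n (mis_rotation n I a b)"
    by (rule tamari_misD[OF tamari_mis_rotation[OF I ab]])
  show "capped_add s I {#(b, a)#} \<subseteq># mis_rotation n I a b"
    unfolding subseteq_mset_def by (auto simp: c count_mis_rotation[OF I ab] mis_added_def)
  fix K assume K: "transitive_mis n K" "capped_add s I {#(b, a)#} \<subseteq># K"
  have le: "count I (y, x) + (if (y, x) = (b, a) then 1 else 0) \<le> count K (y, x)" for y x
    using mset_subset_eq_count[OF K(2), of "(y, x)"] by (simp add: c)
  have "I \<subseteq># K"
    unfolding mis_subset_iff[OF tam(1)] using le by (meson add_leD1)
  moreover have "count I (b, a) < count K (b, a)"
    using le[of b a] by simp
  ultimately show "mis_rotation n I a b \<subseteq># K"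
    using mis_rotation_subset[OF I ab K(1)] by blast
qed

text \<open>Take the last row \<open>b\<close> in which the two sets differ and the last column
  \<open>a\<close> where they differ in it. Above row \<open>b\<close> and to the right of
  \<open>a\<close>, \<open>I\<close> agrees with \<open>K\<close>, which has the inversion
  \<open>(b, a)\<close>; so the ascent conditions for \<open>I\<close> follow from the Tamari
  conditions for \<open>K\<close>.\<close>

lemma exists_mis_ascent:
  assumes I: "tamari_mis n s I" and K: "tamari_mis n s K" and "I \<subseteq># K" "I \<noteq> K"
  obtains a b where "mis_ascent n s I a b" "count I (b, a) < count K (b, a)"
proof -
  note tI = tamari_misD[OF I]
  note tK = tamari_misD[OF K]
  have le: "count I p \<le> count K p" for p using assms(3) by (rule mset_subset_eq_count)
  define B where "B = {b. \<exists>a. count I (b, a) < count K (b, a)}"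
  have "B \<subseteq> {..n}"
  proof
    fix b assume "b \<in> B"
    then obtain a where "count I (b, a) < count K (b, a)" by (auto simp: B_def)
    then have "0 < count K (b, a)" by simp
    from tK(5)[OF this] show "b \<in> {..n}" by simp
  qed
  then have "finite B" by (rule finite_subset) simp
  obtain p where "count I p \<noteq> count K p" using assms(4) by (meson multiset_eqI)
  then have "count I (fst p, snd p) < count K (fst p, snd p)" using le[of p] by simp
  then have "B \<noteq> {}" unfolding B_def by blast
  define b where "b = Max B"
  have "b \<in> B" using \<open>finite B\<close> \<open>B \<noteq> {}\<close> unfolding b_def by (rule Max_in)
  have eq_above: "count I (c, x) = count K (c, x)" if "b < c" for c x
  proof (rule ccontr)
    assume "count I (c, x) \<noteq> count K (c, x)"
    then have "c \<in> B" using le[of "(c, x)"] by (auto simp: B_def nat_less_le)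
    then show False using Max_ge[OF \<open>finite B\<close> \<open>c \<in> B\<close>] that by (simp add: b_def)
  qed
  define A where "A = {a. count I (b, a) < count K (b, a)}"
  have "A \<subseteq> {..b}"
  proof
    fix a assume "a \<in> A"
    then have "0 < count K (b, a)" by (simp add: A_def)
    from tK(5)[OF this] show "a \<in> {..b}" by simp
  qed
  then have "finite A" by (rule finite_subset) simp
  have "A \<noteq> {}" using \<open>b \<in> B\<close> by (auto simp: A_def B_def)
  define a where "a = Max A"
  have "a \<in> A" using \<open>finite A\<close> \<open>A \<noteq> {}\<close> unfolding a_def by (rule Max_in)
  then have ab: "count I (b, a) < count K (b, a)" by (simp add: A_def)
  have eq_right: "count I (b, e) = count K (b, e)" if "a < e" for e
  proof (rule ccontr)
    assume "count I (b, e) \<noteq> count K (b, e)"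
    then have "e \<in> A" using le[of "(b, e)"] by (auto simp: A_def nat_less_le)
    then show False using Max_ge[OF \<open>finite A\<close> \<open>e \<in> A\<close>] that by (simp add: a_def)
  qed
  have r: "1 \<le> a" "a < b" "b \<le> n" using ab tK(5)[of b a] by auto
  have "mis_ascent n s I a b"
    unfolding mis_ascent_def
  proof (intro conjI allI impI)
    show "count I (b, a) < s b" using ab tK(4)[of b a] by simp
    show "count I (c, a) = count I (c, b)" if "b < c \<and> c \<le> n" for c
      using tK(7)[of a b c] that r ab by (simp add: eq_above)
    show "count I (b, a) < count I (b, e)" if "a < e \<and> e < b" for e
      using tK(6)[of a e b] that r ab by (simp add: eq_right)
  qed (use r in auto)
  then show thesis using ab that by blast
qed

section \<open>Intersections and joins of Tamari multi-inversion sets\<close>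

text \<open>Counts are natural numbers, so each infimum is attained. Every required inequality
  between two counts is checked in the member that attains the infimum on its larger side.\<close>

lemma tamari_mis_Inf:
  assumes ne: "\<K> \<noteq> {}" and tam: "\<And>K. K \<in> \<K> \<Longrightarrow> tamari_mis n s K"
  shows "tamari_mis n s (Inf \<K>)"
proof -
  have lower: "count (Inf \<K>) p \<le> count K p" if "K \<in> \<K>" for K p
    using that by (meson mset_subset_eq_count subset_mset.cInf_lower subset_mset.bdd_below_bot)
  have attained: "\<exists>K\<in>\<K>. count (Inf \<K>) p = count K p" for p
    using Inf_nat_def1[of "(\<lambda>X. count X p) ` \<K>"] ne
    by (auto simp: count_Inf_multiset_nonempty[OF ne])
  have supp: "count (Inf \<K>) (y, x) = 0" if "\<not> (1 \<le> x \<and> x < y \<and> y \<le> n)" for y x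
    using attained[of "(y, x)"] tamari_misD(5)[OF tam] that by (metis gr0I)
  have "Inf \<K> = mis_of n (\<lambda>y x. count (Inf \<K>) (y, x))"
  proof (rule multiset_eqI)
    fix p
    show "count (Inf \<K>) p = count (mis_of n (\<lambda>y x. count (Inf \<K>) (y, x))) p"
      using supp by (cases p) (simp only: count_mis_of split: if_split, blast)
  qed
  moreover have "tamari_mis n s (mis_of n (\<lambda>y x. count (Inf \<K>) (y, x)))"
  proof (rule tamari_mis_of)
    show "count (Inf \<K>) (y, x) \<le> s y" for y x
      using attained[of "(y, x)"] tamari_misD(4)[OF tam] by metis
    show "count (Inf \<K>) (c, a) \<le> count (Inf \<K>) (c, b)" if "1 \<le> a" "a < b" "b < c" "c \<le> n" for a b c
      using attained[of "(c, b)"] lower[of _ "(c, a)"] tamari_misD(6)[OF tam that] by (metis order_trans)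
    show "count (Inf \<K>) (c, b) \<le> count (Inf \<K>) (c, a)"
      if h: "1 \<le> a" "a < b" "b < c" "c \<le> n" "0 < count (Inf \<K>) (b, a)" for a b c
    proof -
      obtain K where K: "K \<in> \<K>" "count (Inf \<K>) (c, a) = count K (c, a)"
        using attained by blast
      have "0 < count K (b, a)" using lower[OF K(1), of "(b, a)"] h by simp
      then show ?thesis
        using lower[OF K(1), of "(c, b)"] K tamari_misD(7)[OF tam[OF K(1)] h(1-4)] by simp
    qed
  qed
  ultimately show ?thesis by simp
qed

text \<open>Upper bounds of the rotations in \<open>F\<close>, by the one-entry test of
  \<open>mis_rotation_subset\<close>. Ascents are pairs \<open>(a, b)\<close> with the smaller entry
  first, opposite to the pairs counted by a multi-inversion set.\<close>

definition mis_above ::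
    "nat \<Rightarrow> (nat \<Rightarrow> nat) \<Rightarrow> (nat \<times> nat) multiset \<Rightarrow> (nat \<times> nat) set \<Rightarrow> (nat \<times> nat) multiset set" where
  "mis_above n s I F =
     {K. tamari_mis n s K \<and> I \<subseteq># K \<and> (\<forall>(a, b)\<in>F. count I (b, a) < count K (b, a))}"

definition mis_join ::
    "nat \<Rightarrow> (nat \<Rightarrow> nat) \<Rightarrow> (nat \<times> nat) multiset \<Rightarrow> (nat \<times> nat) set \<Rightarrow> (nat \<times> nat) multiset" where
  "mis_join n s I F = Inf (mis_above n s I F)"

lemma mis_join_subset: "K \<in> mis_above n s I F \<Longrightarrow> mis_join n s I F \<subseteq># K"
  unfolding mis_join_def by (simp add: subset_mset.cInf_lower)

lemma mis_join_in:
  assumes I: "tamari_mis n s I" and F: "\<And>a b. (a, b) \<in> F \<Longrightarrow> mis_ascent n s I a b"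
  shows "mis_join n s I F \<in> mis_above n s I F"
proof -
  \<comment> \<open>The top element, with every entry at its cap: it is an upper bound of all
    rotations, so the infimum is over a nonempty family.\<close>
  define M where "M = mis_of n (\<lambda>y x. s y)"
  have "tamari_mis n s M"
    unfolding M_def by (rule tamari_mis_of) auto
  moreover have "I \<subseteq># M"
    unfolding mis_subset_iff[OF tamari_misD(1)[OF I]]
    using tamari_misD(4)[OF I] by (simp add: M_def count_mis_of)
  moreover have "count I (b, a) < count M (b, a)" if "(a, b) \<in> F" for a b
    using mis_ascentD[OF F[OF that]] by (simp add: M_def count_mis_of)
  ultimately have ne: "mis_above n s I F \<noteq> {}" unfolding mis_above_def by blast
  have *: "\<exists>K\<in>mis_above n s I F. count (mis_join n s I F) p = count K p" for p
    using Inf_nat_def1[of "(\<lambda>X. count X p) ` mis_above n s I F"] ne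
    by (auto simp: mis_join_def count_Inf_multiset_nonempty[OF ne])
  then have "count I (b, a) < count (mis_join n s I F) (b, a)" if ab: "(a, b) \<in> F" for a b
  proof -
    obtain K where "K \<in> mis_above n s I F" "count (mis_join n s I F) (b, a) = count K (b, a)"
      using * by blast
    then show ?thesis using ab by (auto simp: mis_above_def)
  qed
  moreover have "I \<subseteq># mis_join n s I F"
    unfolding mis_join_def using ne by (rule subset_mset.cInf_greatest) (simp add: mis_above_def)
  moreover have "tamari_mis n s (mis_join n s I F)"
    unfolding mis_join_def using ne by (rule tamari_mis_Inf) (simp add: mis_above_def)
  ultimately show ?thesis
    unfolding mis_above_def by blast
qed

lemma mis_join_mono:
  assumes I: "tamari_mis n s I" and F: "\<And>a b. (a, b) \<in> F \<Longrightarrow> mis_ascent n s I a b" and "G \<subseteq> F"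
  shows "mis_join n s I G \<subseteq># mis_join n s I F"
  using mis_join_in[of n s I F] assms by (intro mis_join_subset) (auto simp: mis_above_def)

text \<open>The witness \<open>K\<close> is the largest Tamari multi-inversion set above \<open>I\<close> that does not
  increase the multiplicity of \<open>(b, a)\<close>.\<close>

lemma count_mis_join_notin:
  assumes I: "tamari_mis n s I" and F: "\<And>a b. (a, b) \<in> F \<Longrightarrow> mis_ascent n s I a b"
    and ab: "mis_ascent n s I a b" "(a, b) \<notin> F"
  shows "count (mis_join n s I F) (b, a) = count I (b, a)"
proof -
  note tam = tamari_misD[OF I]
  note asc = mis_ascentD[OF ab(1)]
  define f where "f = (\<lambda>y x. if y \<le> a \<or> b < y \<or> a < x then s y
                            else if y = b then count I (b, a) else 0)"
  define K where "K = mis_of n f"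
  have cK: "count K (y, x) = f y x" if "1 \<le> x" "x < y" "y \<le> n" for y x
    using that by (simp add: K_def count_mis_of)
  have "tamari_mis n s K"
    unfolding K_def
  proof (rule tamari_mis_of)
    show "f y x \<le> s y" for x y using asc(4) by (auto simp: f_def)
    show "f c x \<le> f c y" if "1 \<le> x" "x < y" "y < c" "c \<le> n" for x y c
      using that asc(4) by (auto simp: f_def)
    show "f c y \<le> f c x" if "1 \<le> x" "x < y" "y < c" "c \<le> n" "0 < f y x" for x y c
      using that asc(4) by (auto simp: f_def split: if_splits)
  qed
  moreover have "I \<subseteq># K"
    unfolding mis_subset_iff[OF tam(1)]
  proof (intro allI impI)
    fix y x assume yx: "1 \<le> x \<and> x < y \<and> y \<le> n"
    have "count I (b, x) \<le> count I (b, a)" if "x \<le> a"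
      using tam(6)[of x a b] asc yx that by (cases "x = a") auto
    \<comment> \<open>An inversion \<open>(y, x)\<close> would equate the entries of row
      \<open>b\<close> at \<open>x\<close> and \<open>y\<close>, but the ascent makes the entry at
      \<open>y\<close> exceed the one at \<open>a\<close>, which bounds the one at \<open>x\<close>.
      So the zeros of \<open>f\<close> are zeros of \<open>I\<close>.\<close>
    moreover have "count I (y, x) = 0" if "a < y" "y < b" "x \<le> a"
    proof (rule ccontr)
      assume "count I (y, x) \<noteq> 0"
      then have "count I (b, x) = count I (b, y)" using tam(7)[of x y b] yx that asc by auto
      moreover have "count I (b, x) \<le> count I (b, a)"
        using tam(6)[of x a b] asc yx that by (cases "x = a") auto
      ultimately show False using asc(6)[OF that(1,2)] by simp
    qed
    ultimately show "count I (y, x) \<le> count K (y, x)"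
      using yx tam(4)[of y x] by (auto simp: cK f_def)
  qed
  moreover have "count I (b', a') < count K (b', a')" if mem: "(a', b') \<in> F" for a' b'
  proof -
    note asc' = mis_ascentD[OF F[OF mem]]
    have "count I (b', a') < f b' a'"
    proof (cases "b' \<le> a \<or> b < b' \<or> a < a'")
      case False
      show ?thesis
      proof (cases "b' = b")
        case True
        then have "a' < a" using False ab(2) mem by (cases "a' = a") auto
        then show ?thesis using asc'(6)[of a] True False asc by (simp add: f_def)
      next
        case False': False
        \<comment> \<open>No ascent falls into this case: \<open>(a', b')\<close> would equate the
          entries of row \<open>b\<close> at \<open>a'\<close> and \<open>b'\<close>, although they
          lie on opposite sides of the strict increase at \<open>a\<close>.\<close>
        then have "a < b'" "b' < b" using False by auto
        then have "count I (b, a') = count I (b, b')" using asc'(5)[of b] asc by simp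
        moreover have "count I (b, a') \<le> count I (b, a)"
          using tam(6)[of a' a b] asc asc' False by (cases "a' = a") auto
        ultimately show ?thesis using asc(6)[of b'] \<open>a < b'\<close> \<open>b' < b\<close> by simp
      qed
    qed (simp add: f_def asc'(4))
    then show ?thesis using asc' by (simp add: cK)
  qed
  ultimately have "K \<in> mis_above n s I F" by (auto simp: mis_above_def)
  from mset_subset_eq_count[OF mis_join_subset[OF this], of "(b, a)"]
  have "count (mis_join n s I F) (b, a) \<le> count I (b, a)"
    using asc by (simp add: cK f_def)
  moreover have "I \<subseteq># mis_join n s I F" using mis_join_in[OF I F] by (simp add: mis_above_def)
  ultimately show ?thesis using mset_subset_eq_count le_antisym by metis
qed

section \<open>The closure of the capped sum of the added sets\<close>

text \<open>All raised entries carry the value of their ascent, and two ascents in the same row with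
  the same value violate the strict increase to the right of the smaller one.\<close>

lemma mis_added_disjoint:
  assumes I: "tamari_mis n s I" and "mis_ascent n s I a b" "mis_ascent n s I a' b'"
    and "p \<in> mis_added I a b" "p \<in> mis_added I a' b'"
  shows "a = a'" "b = b'"
proof -
  obtain y x where p: "p = (y, x)" by fastforce
  note A = mis_addedD[OF I assms(2), of y x] mis_addedD[OF I assms(3), of y x]
  show b: "b = b'" using A(1,6) assms(4,5) p by simp
  have "count I (b, a) = count I (b, a')" using A(4,9) assms(4,5) p b by simp
  then show "a = a'"
    using mis_ascentD(6)[OF assms(2), of a'] mis_ascentD(6)[OF assms(3), of a]
      mis_ascentD(2)[OF assms(2)] mis_ascentD(2)[OF assms(3)] b
    by (cases a a' rule: linorder_cases) auto
qed

text \<open>By disjointness an entry is raised at most once, and it starts below its cap. Hence the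
  truncated sum never truncates and its value does not depend on the order of the list.\<close>

lemma count_foldl_capped_add:
  assumes I: "tamari_mis n s I"
    and "distinct as" and "\<And>a b. (a, b) \<in> set as \<Longrightarrow> mis_ascent n s I a b"
  shows "count (foldl (\<lambda>I' (a, b). capped_add s I' (mset_set (mis_added I a b))) I as) p =
    count I p + (if \<exists>(a, b)\<in>set as. p \<in> mis_added I a b then 1 else 0)"
  using assms(2,3)
proof (induction as rule: rev_induct)
  case (snoc ab as)
  obtain a b where ab: "ab = (a, b)" by fastforce
  obtain y x where p: "p = (y, x)" by fastforce
  have asc: "mis_ascent n s I a b" using snoc.prems ab by simp
  have IH: "count (foldl (\<lambda>I' (a, b). capped_add s I' (mset_set (mis_added I a b))) I as) p =
    count I p + (if \<exists>(a, b)\<in>set as. p \<in> mis_added I a b then 1 else 0)"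
    using snoc by simp
  have disj: "p \<notin> mis_added I a' b'" if "p \<in> mis_added I a b" "(a', b') \<in> set as" for a' b'
  proof
    assume "p \<in> mis_added I a' b'"
    then have "a = a'" "b = b'"
      using mis_added_disjoint[OF I asc snoc.prems(2)[of a' b'] that(1)] that(2) by auto
    then show False using snoc.prems(1) that(2) ab by simp
  qed
  have lt: "count I p < s y" if "p \<in> mis_added I a' b'" "mis_ascent n s I a' b'" for a' b'
    using mis_addedD(1,4)[OF I that(2), of y x] that(1) mis_ascentD(4)[OF that(2)]
    unfolding p by auto
  have le: "count I p \<le> s y" using tamari_misD(4)[OF I] p by simp
  have lt': "count I p < s y" if "\<exists>(a', b')\<in>set as. p \<in> mis_added I a' b'"
    using that lt snoc.prems by fastforce
  show ?case
  proof (cases "p \<in> mis_added I a b")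
    case True
    then have no: "\<not> (\<exists>(a', b')\<in>set as. p \<in> mis_added I a' b')" using disj by blast
    have "count (foldl (\<lambda>I' (a, b). capped_add s I' (mset_set (mis_added I a b))) I as) p = count I p"
      unfolding IH using no by simp
    moreover have "count I p < s y" using lt[OF True asc] .
    ultimately show ?thesis
      using True unfolding p ab by (simp add: count_capped_add finite_mis_added[OF I])
  next
    case False
    then have "(\<exists>(a', b')\<in>set (as @ [ab]). p \<in> mis_added I a' b') \<longleftrightarrow>
      (\<exists>(a', b')\<in>set as. p \<in> mis_added I a' b')" using ab by auto
    then show ?thesis
      using False le lt' IH unfolding p ab
      by (simp add: count_capped_add finite_mis_added[OF I] min_absorb1 Suc_leI)
  qed
qed simp

text \<open>The join is least among Tamari sets, the closure among transitive ones, so only the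
  inclusion of the join in the closure is at stake. It holds once the closure is Tamari: its entries
  are bounded by those of the join, and its rows are monotone because those of \<open>S\<close>
  are.\<close>

lemma mis_join_eq_trans_closure:
  assumes I: "tamari_mis n s I"
    and "distinct as" and as: "\<And>a b. (a, b) \<in> set as \<Longrightarrow> mis_ascent n s I a b"
  shows "trans_closure n (foldl (\<lambda>I' (a, b). capped_add s I' (mset_set (mis_added I a b))) I as) =
    mis_join n s I (set as)"
proof -
  define S where "S = foldl (\<lambda>I' (a, b). capped_add s I' (mset_set (mis_added I a b))) I as"
  define J where "J = mis_join n s I (set as)"
  have cS: "count S p = count I p + (if \<exists>(a, b)\<in>set as. p \<in> mis_added I a b then 1 else 0)" for p
    unfolding S_def by (rule count_foldl_capped_add[OF assms])
  have J: "tamari_mis n s J" "I \<subseteq># J" "\<And>a b. (a, b) \<in> set as \<Longrightarrow> count I (b, a) < count J (b, a)"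
    using mis_join_in[OF I as] by (auto simp: J_def mis_above_def)
  have rot: "count (mis_rotation n I a b) p \<le> count J p" if "(a, b) \<in> set as" for a b p
    by (rule mset_subset_eq_count, rule mis_rotation_subset[OF I as[OF that] _ J(2) J(3)[OF that]])
      (rule tamari_misD[OF J(1)])
  have "S \<subseteq># J"
    unfolding subseteq_mset_def
  proof
    fix p
    show "count S p \<le> count J p"
    proof (cases "\<exists>(a, b)\<in>set as. p \<in> mis_added I a b")
      case True
      then obtain a b where "(a, b) \<in> set as" "p \<in> mis_added I a b" by blast
      then show ?thesis
        using rot[of a b p] count_mis_rotation[OF I as, of a b "fst p" "snd p"] True by (simp add: cS)
    next
      case False
      then show ?thesis using mset_subset_eq_count[OF J(2), of p] unfolding cS by simp
    qed
  qed
  then have S: "multi_inversion_set n S"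
    using tamari_misD(1)[OF J(1)] set_mset_mono unfolding multi_inversion_set_def by blast
  have "I \<subseteq># S" unfolding subseteq_mset_def cS by simp
  have "monotone_mis n S"
    unfolding monotone_mis_def
  proof (intro allI impI)
    fix x y c assume h: "1 \<le> x \<and> x < y \<and> y < c \<and> c \<le> n"
    show "count S (c, x) \<le> count S (c, y)"
    proof (cases "\<exists>(a, b)\<in>set as. (c, x) \<in> mis_added I a b")
      case True
      then obtain a b where ab: "(a, b) \<in> set as" "(c, x) \<in> mis_added I a b" by blast
      \<comment> \<open>Where \<open>S\<close> is raised it coincides with a single rotation, whose
        rows are monotone and which stays below \<open>S\<close> everywhere in the row.\<close>
      have "count S (c, x) = count (mis_rotation n I a b) (c, x)"
        unfolding cS count_mis_rotation[OF I as[OF ab(1)]] using ab(2) True by simp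
      also have "\<dots> \<le> count (mis_rotation n I a b) (c, y)"
        using tamari_misD(6)[OF tamari_mis_rotation[OF I as[OF ab(1)]]] h by blast
      also have "\<dots> \<le> count S (c, y)"
        unfolding cS count_mis_rotation[OF I as[OF ab(1)]] using ab(1) by auto
      finally show ?thesis .
    next
      case False
      then show ?thesis using tamari_misD(6)[OF I, of x y c] h unfolding cS by simp
    qed
  qed
  note tc = trans_closureD[OF S]
  have "trans_closure n S \<subseteq># J" using tc(3) \<open>S \<subseteq># J\<close> tamari_misD[OF J(1)] by blast
  moreover have "J \<subseteq># trans_closure n S"
  proof -
    have "count (trans_closure n S) (y, x) \<le> s y" for y x
      using mset_subset_eq_count[OF \<open>trans_closure n S \<subseteq># J\<close>, of "(y, x)"]
        tamari_misD(4)[OF J(1), of y x] by simp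
    then have "tamari_mis n s (trans_closure n S)"
      using tc(1) monotone_trans_closure[OF S \<open>monotone_mis n S\<close>] by (simp add: tamari_mis_def)
    moreover have "I \<subseteq># trans_closure n S" using \<open>I \<subseteq># S\<close> tc(2) by (rule subset_mset.order_trans)
    moreover have "count I (b, a) < count (trans_closure n S) (b, a)" if "(a, b) \<in> set as" for a b
    proof -
      have "count I (b, a) < count S (b, a)" unfolding cS using that by (auto simp: mis_added_def)
      then show ?thesis using mset_subset_eq_count[OF tc(2), of "(b, a)"] by simp
    qed
    ultimately show ?thesis
      unfolding J_def by (intro mis_join_subset) (auto simp: mis_above_def)
  qed
  ultimately show ?thesis unfolding S_def J_def by (rule subset_mset.antisym)
qed

section \<open>Trees and their inversion sets\<close>

lemma distinct_concat_map_iff: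
  "distinct (concat (map f ts)) \<longleftrightarrow> (\<forall>t\<in>set ts. distinct (f t)) \<and>
     (\<forall>i<length ts. \<forall>j<length ts. i \<noteq> j \<longrightarrow> set (f (ts ! i)) \<inter> set (f (ts ! j)) = {})"
proof (induction ts)
  case (Cons t ts)
  have "(\<Union>x\<in>set ts. set (f x)) = (\<Union>j<length ts. set (f (ts ! j)))"
    by (auto simp: set_conv_nth)
  then show ?case
    using Cons.IH by (simp add: All_less_Suc2) blast
qed simp

text \<open>Decreasing trees with an arbitrary label set, a notion that passes to the branches of
  the root and so permits induction.\<close>

definition s_tree :: "(nat \<Rightarrow> nat) \<Rightarrow> ptree \<Rightarrow> bool" where
  "s_tree s T \<longleftrightarrow> distinct (labels T) \<and>
     (\<forall>x ts. Node x ts \<in> subtrees T \<longrightarrow>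
        length ts = s x + 1 \<and> (\<forall>t\<in>set ts. \<forall>y\<in>set (labels t). y < x))"

lemma decreasing_tree_iff: "decreasing_tree n s T \<longleftrightarrow> s_tree s T \<and> set (labels T) = {1..n}"
  by (auto simp: decreasing_tree_def s_tree_def)

lemma s_tree_Node:
  "s_tree s (Node r ts) \<longleftrightarrow> length ts = s r + 1 \<and>
     (\<forall>t\<in>set ts. s_tree s t \<and> (\<forall>y\<in>set (labels t). y < r)) \<and>
     (\<forall>i<length ts. \<forall>j<length ts. i \<noteq> j \<longrightarrow>
        set (labels (ts ! i)) \<inter> set (labels (ts ! j)) = {})"
proof -
  define D where "D \<longleftrightarrow> (\<forall>i<length ts. \<forall>j<length ts. i \<noteq> j \<longrightarrow>
        set (labels (ts ! i)) \<inter> set (labels (ts ! j)) = {})"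
  have "(\<forall>x us. Node x us \<in> subtrees (Node r ts) \<longrightarrow>
        length us = s x + 1 \<and> (\<forall>t\<in>set us. \<forall>y\<in>set (labels t). y < x)) \<longleftrightarrow>
      (length ts = s r + 1 \<and> (\<forall>t\<in>set ts. \<forall>y\<in>set (labels t). y < r)) \<and>
      (\<forall>t\<in>set ts. \<forall>x us. Node x us \<in> subtrees t \<longrightarrow>
        length us = s x + 1 \<and> (\<forall>t\<in>set us. \<forall>y\<in>set (labels t). y < x))"
    by auto
  moreover have "distinct (labels (Node r ts)) \<longleftrightarrow>
      (\<forall>t\<in>set ts. r \<notin> set (labels t)) \<and> (\<forall>t\<in>set ts. distinct (labels t)) \<and>
      (\<forall>i<length ts. \<forall>j<length ts. i \<noteq> j \<longrightarrow> set (labels (ts ! i)) \<inter> set (labels (ts ! j)) = {})"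
    by (simp add: distinct_concat_map_iff)
  ultimately have "s_tree s (Node r ts) \<longleftrightarrow>
      ((\<forall>t\<in>set ts. r \<notin> set (labels t)) \<and> (\<forall>t\<in>set ts. distinct (labels t)) \<and> D) \<and>
      (length ts = s r + 1 \<and> (\<forall>t\<in>set ts. \<forall>y\<in>set (labels t). y < r)) \<and>
      (\<forall>t\<in>set ts. \<forall>x us. Node x us \<in> subtrees t \<longrightarrow>
        length us = s x + 1 \<and> (\<forall>t\<in>set us. \<forall>y\<in>set (labels t). y < x))"
    unfolding s_tree_def D_def by (simp only:)
  also have "\<dots> \<longleftrightarrow> length ts = s r + 1 \<and>
     (\<forall>t\<in>set ts. s_tree s t \<and> (\<forall>y\<in>set (labels t). y < r)) \<and> D"
    unfolding s_tree_def by (auto dest: bspec)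
  finally show ?thesis unfolding D_def .
qed

lemma s_tree_NodeD:
  assumes "s_tree s (Node r ts)"
  shows "length ts = s r + 1"
    and "i < length ts \<Longrightarrow> s_tree s (ts ! i)"
    and "\<lbrakk>i < length ts; y \<in> set (labels (ts ! i))\<rbrakk> \<Longrightarrow> y < r"
    and "\<lbrakk>i < length ts; j < length ts; y \<in> set (labels (ts ! i)); y \<in> set (labels (ts ! j))\<rbrakk> \<Longrightarrow> i = j"
proof -
  show "length ts = s r + 1" using assms unfolding s_tree_Node by blast
  show "i < length ts \<Longrightarrow> s_tree s (ts ! i)"
    and "\<lbrakk>i < length ts; y \<in> set (labels (ts ! i))\<rbrakk> \<Longrightarrow> y < r"
    using assms nth_mem unfolding s_tree_Node by blast+
  show "\<lbrakk>i < length ts; j < length ts; y \<in> set (labels (ts ! i)); y \<in> set (labels (ts ! j))\<rbrakk> \<Longrightarrow> i = j"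
    using assms unfolding s_tree_Node by blast
qed

lemma labels_Node_cases:
  assumes "x \<in> set (labels (Node r ts))"
  obtains "x = r" | i where "i < length ts" "x \<in> set (labels (ts ! i))"
proof -
  have "x = r \<or> (\<exists>t\<in>set ts. x \<in> set (labels t))" using assms by auto
  then show thesis using that by (metis in_set_conv_nth)
qed

lemma labels_childI: "\<lbrakk>i < length ts; x \<in> set (labels (ts ! i))\<rbrakk> \<Longrightarrow> x \<in> set (labels (Node r ts))"
  by (auto dest: nth_mem)

lemma labels_le_root: "\<lbrakk>s_tree s (Node r ts); x \<in> set (labels (Node r ts))\<rbrakk> \<Longrightarrow> x \<le> r"
  by (auto simp: s_tree_Node dest: less_imp_le)

lemma labels_subtree: "U \<in> subtrees T \<Longrightarrow> set (labels U) \<subseteq> set (labels T)"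
  by (induction T) auto

lemma in_branch_labels:
  assumes "in_branch T y j x"
  shows "y \<in> set (labels T)" "x \<in> set (labels T)"
proof -
  obtain ts where ts: "Node y ts \<in> subtrees T" "j < length ts" "x \<in> set (labels (ts ! j))"
    using assms by (auto simp: in_branch_def)
  from labels_subtree[OF ts(1)] show "y \<in> set (labels T)" by simp
  from labels_subtree[OF ts(1)] labels_childI[OF ts(2,3)] show "x \<in> set (labels T)" by blast
qed

lemma left_of_labels:
  assumes "left_of T x y"
  shows "x \<in> set (labels T)" "y \<in> set (labels T)"
  using assms in_branch_labels unfolding left_of_def by blast+

lemma in_branch_Node:
  "in_branch (Node r ts) y j x \<longleftrightarrow>
     y = r \<and> j < length ts \<and> x \<in> set (labels (ts ! j)) \<or> (\<exists>t\<in>set ts. in_branch t y j x)"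
  unfolding in_branch_def by auto

lemma in_branch_root:
  assumes "s_tree s (Node r ts)"
  shows "in_branch (Node r ts) r j x \<longleftrightarrow> j < length ts \<and> x \<in> set (labels (ts ! j))"
  using assms in_branch_labels(1) unfolding in_branch_Node s_tree_Node by blast

lemma in_branch_child:
  assumes T: "s_tree s (Node r ts)" and k: "k < length ts" "y \<in> set (labels (ts ! k))"
  shows "in_branch (Node r ts) y j x \<longleftrightarrow> in_branch (ts ! k) y j x"
proof -
  have "t = ts ! k" if "t \<in> set ts" "in_branch t y j x" for t
    using that s_tree_NodeD(4)[OF T _ k(1) _ k(2)] in_branch_labels(1)[OF that(2)]
    by (metis in_set_conv_nth)
  moreover have "y \<noteq> r" using s_tree_NodeD(3)[OF T k] by simp
  ultimately show ?thesis unfolding in_branch_Node using k(1) by (auto dest: nth_mem)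
qed

lemma left_of_Node:
  assumes T: "s_tree s (Node r ts)"
  shows "left_of (Node r ts) x y \<longleftrightarrow>
     (\<exists>i j. i < j \<and> j < length ts \<and> x \<in> set (labels (ts ! i)) \<and> y \<in> set (labels (ts ! j))) \<or>
     (\<exists>k<length ts. left_of (ts ! k) x y)" (is "?L \<longleftrightarrow> ?R")
proof
  assume ?L
  then obtain z i j where z: "in_branch (Node r ts) z i x" "in_branch (Node r ts) z j y" "i < j"
    by (auto simp: left_of_def)
  from labels_Node_cases[OF in_branch_labels(1)[OF z(1)]] show ?R
  proof cases
    case 1
    then show ?thesis using z by (auto simp: in_branch_root[OF T])
  next
    case (2 k)
    then show ?thesis using z unfolding in_branch_child[OF T 2] left_of_def by blast
  qed
next
  assume ?R
  then show ?L
  proof (elim disjE exE conjE)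
    fix i j assume "i < j" "j < length ts" "x \<in> set (labels (ts ! i))" "y \<in> set (labels (ts ! j))"
    then show ?L unfolding left_of_def
      by (intro exI[of _ r] exI[of _ i] exI[of _ j]) (simp add: in_branch_root[OF T])
  next
    fix k assume "k < length ts" "left_of (ts ! k) x y"
    then show ?L unfolding left_of_def in_branch_Node by (meson nth_mem)
  qed
qed

lemma left_of_children:
  assumes T: "s_tree s (Node r ts)" and i: "i < length ts" "x \<in> set (labels (ts ! i))"
    and k: "k < length ts" "y \<in> set (labels (ts ! k))"
  shows "left_of (Node r ts) x y \<longleftrightarrow> i < k \<or> i = k \<and> left_of (ts ! k) x y"
  unfolding left_of_Node[OF T]
proof (intro iffI; elim disjE exE conjE)
  fix i' k' assume h: "i' < k'" "k' < length ts" "x \<in> set (labels (ts ! i'))" "y \<in> set (labels (ts ! k'))"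
  have "i' = i" using s_tree_NodeD(4)[OF T _ i(1) h(3) i(2)] h by simp
  moreover have "k' = k" using s_tree_NodeD(4)[OF T h(2) k(1) h(4) k(2)] .
  ultimately show "i < k \<or> i = k \<and> left_of (ts ! k) x y" using h(1) by simp
next
  fix j assume h: "j < length ts" "left_of (ts ! j) x y"
  have "j = i" using s_tree_NodeD(4)[OF T h(1) i(1) left_of_labels(1)[OF h(2)] i(2)] .
  moreover have "j = k" using s_tree_NodeD(4)[OF T h(1) k(1) left_of_labels(2)[OF h(2)] k(2)] .
  ultimately show "i < k \<or> i = k \<and> left_of (ts ! k) x y" using h(2) by simp
qed (use i k in blast)+

section \<open>Multiplicities computed from the root\<close>

text \<open>Nothing lies to the left or right of the root, so only the branch cases of
  \<open>tree_mult\<close> remain. They all return the branch index, the last one because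
  \<open>s r\<close> is the index of the last branch.\<close>

lemma tree_mult_root:
  assumes T: "s_tree s (Node r ts)" and i: "i < length ts" "x \<in> set (labels (ts ! i))"
  shows "tree_mult s (Node r ts) r x = i"
proof -
  have b: "in_branch (Node r ts) r j x \<longleftrightarrow> j = i" for j
    using in_branch_root[OF T] i s_tree_NodeD(4)[OF T] by metis
  have notr: "r \<notin> set (labels (ts ! k))" if "k < length ts" for k
    using s_tree_NodeD(3)[OF T that] by blast
  have "\<not> left_of (Node r ts) x r" "\<not> left_of (Node r ts) r x"
    unfolding left_of_Node[OF T] using notr left_of_labels by (meson less_trans)+
  moreover have "(THE j. 0 < j \<and> j < s r \<and> j = i) = i" if "i \<noteq> 0" "i \<noteq> s r"
    using that i s_tree_NodeD(1)[OF T] by (intro the_equality) auto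
  ultimately show ?thesis
    unfolding tree_mult_def b by auto
qed

lemma tree_mult_child:
  assumes T: "s_tree s (Node r ts)" and i: "i < length ts" "x \<in> set (labels (ts ! i))"
    and k: "k < length ts" "y \<in> set (labels (ts ! k))"
  shows "tree_mult s (Node r ts) y x =
    (if i < k then 0 else if k < i then s y else tree_mult s (ts ! k) y x)"
proof -
  note u = s_tree_NodeD(4)[OF T]
  have uniq: "i' = i" if "x \<in> set (labels (ts ! i'))" "i' < length ts" for i'
    using u[OF that(2) i(1) that(1) i(2)] .
  note L = left_of_children[OF T i k]
  have R: "left_of (Node r ts) y x \<longleftrightarrow> k < i \<or> i = k \<and> left_of (ts ! k) y x"
    using left_of_children[OF T k i] by auto
  have "\<not> in_branch (ts ! k) y j x" if "i \<noteq> k" for j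
    using that uniq[OF in_branch_labels(2) k(1)] by blast
  then show ?thesis
    unfolding tree_mult_def L R in_branch_child[OF T k] by auto
qed

lemma tree_mult_le:
  assumes "s_tree s T" "x \<in> set (labels T)" "y \<in> set (labels T)" "x < y"
  shows "tree_mult s T y x \<le> s y"
  using assms
proof (induction T)
  case (Node r ts)
  note T = Node.prems(1)
  note le = labels_le_root[OF T]
  have "x \<noteq> r" using le[OF Node.prems(3)] Node.prems(4) by simp
  then obtain i where i: "i < length ts" "x \<in> set (labels (ts ! i))"
    using labels_Node_cases[OF Node.prems(2)] by blast
  from Node.prems(3) show ?case
  proof (cases rule: labels_Node_cases)
    case 1
    then show ?thesis using tree_mult_root[OF T i] i s_tree_NodeD(1)[OF T] by simp
  next
    case (2 k)
    show ?thesis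
      unfolding tree_mult_child[OF T i 2]
      using Node.IH[OF nth_mem[OF 2(1)] s_tree_NodeD(2)[OF T 2(1)]] i 2 Node.prems(4)
      by (cases i k rule: linorder_cases) auto
  qed
qed simp

text \<open>Positivity at \<open>(b, a)\<close> puts \<open>a\<close> into the root branch of
  \<open>b\<close> or one further right. If \<open>c\<close> is the root this compares branch
  indices; if \<open>c\<close> lies in branch \<open>k\<close>, a branch left of \<open>k\<close>
  gives \<open>b\<close> multiplicity 0, one right of \<open>k\<close> gives \<open>a\<close> the
  maximum \<open>s c\<close>, and otherwise all three share a branch.\<close>

lemma tree_mult_transitive:
  assumes "s_tree s T" "a \<in> set (labels T)" "b \<in> set (labels T)" "c \<in> set (labels T)" "a < b" "b < c"
    and "0 < tree_mult s T b a"
  shows "tree_mult s T c b \<le> tree_mult s T c a"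
  using assms
proof (induction T)
  case (Node r ts)
  note T = Node.prems(1)
  have "a \<noteq> r" "b \<noteq> r" using labels_le_root[OF T Node.prems(4)] Node.prems(5,6) by simp_all
  then obtain i j where i: "i < length ts" "a \<in> set (labels (ts ! i))"
    and j: "j < length ts" "b \<in> set (labels (ts ! j))"
    using labels_Node_cases[OF Node.prems(2)] labels_Node_cases[OF Node.prems(3)] by metis
  have ij: "j \<le> i" "i = j \<Longrightarrow> 0 < tree_mult s (ts ! j) b a"
    using Node.prems(7) tree_mult_child[OF T i j] by (auto split: if_splits)
  from Node.prems(4) show ?case
  proof (cases rule: labels_Node_cases)
    case 1
    then show ?thesis using tree_mult_root[OF T i] tree_mult_root[OF T j] ij by simp
  next
    case (2 k)
    note tk = s_tree_NodeD(2)[OF T 2(1)]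
    have "tree_mult s (ts ! k) c b \<le> s c" if "j = k"
      using tree_mult_le[OF tk _ 2(2)] that j Node.prems(6) by simp
    moreover have "tree_mult s (ts ! k) c b \<le> tree_mult s (ts ! k) c a" if "j = k" "i = k"
      using Node.IH[OF nth_mem[OF 2(1)] tk] that i j 2 ij Node.prems(5,6) by simp
    ultimately show ?thesis
      unfolding tree_mult_child[OF T i 2] tree_mult_child[OF T j 2] using ij by auto
  qed
qed simp

lemma labels_child_eq:
  assumes T: "s_tree s (Node r ts)" and i: "i < length ts"
  shows "set (labels (ts ! i)) =
    {x \<in> set (labels (Node r ts)). x < r \<and> tree_mult s (Node r ts) r x = i}"
proof (intro equalityI subsetI)
  fix x assume "x \<in> set (labels (ts ! i))"
  then show "x \<in> {x \<in> set (labels (Node r ts)). x < r \<and> tree_mult s (Node r ts) r x = i}"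
    using labels_childI[OF i, of x r] s_tree_NodeD(3)[OF T i] tree_mult_root[OF T i] by blast
next
  fix x assume "x \<in> {x \<in> set (labels (Node r ts)). x < r \<and> tree_mult s (Node r ts) r x = i}"
  then have x: "x \<in> set (labels (Node r ts))" "x \<noteq> r" "tree_mult s (Node r ts) r x = i" by auto
  from x(1) show "x \<in> set (labels (ts ! i))"
    by (cases rule: labels_Node_cases) (use x tree_mult_root[OF T] in auto)
qed

text \<open>The root is the largest label, and the multiplicities in its row say which labels form
  each branch (\<open>labels_child_eq\<close>). Induction on the branches does the rest.\<close>

lemma s_tree_eqI:
  assumes "s_tree s T" "s_tree s T'" "set (labels T) = set (labels T')"
    and "\<And>x y. \<lbrakk>x \<in> set (labels T); y \<in> set (labels T); x < y\<rbrakk> \<Longrightarrow> tree_mult s T y x = tree_mult s T' y x"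
  shows "T = T'"
  using assms
proof (induction T arbitrary: T')
  case Leaf
  then show ?case by (cases T') auto
next
  case (Node r ts)
  note T = Node.prems(1)
  obtain r' ts' where T'eq: "T' = Node r' ts'" using Node.prems(3) by (cases T') auto
  note T' = Node.prems(2)[unfolded T'eq]
  note lab = Node.prems(3)[unfolded T'eq]
  have "r' \<in> set (labels (Node r ts))" "r \<in> set (labels (Node r' ts'))" using lab by auto
  from labels_le_root[OF T this(1)] labels_le_root[OF T' this(2)] have r: "r' = r" by simp
  have len: "length ts = length ts'" using s_tree_NodeD(1)[OF T] s_tree_NodeD(1)[OF T'] r by simp
  have "ts ! i = ts' ! i" if i: "i < length ts" for i
  proof (rule Node.IH)
    have i': "i < length ts'" using i len by simp
    show "ts ! i \<in> set ts" "s_tree s (ts ! i)" "s_tree s (ts' ! i)"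
      using i len s_tree_NodeD(2)[OF T] s_tree_NodeD(2)[OF T'] by auto
    have "tree_mult s (Node r ts) r x = tree_mult s T' r x"
      if "x \<in> set (labels (Node r ts))" "x < r" for x
      using Node.prems(4)[OF that(1) _ that(2)] by simp
    then show eq: "set (labels (ts ! i)) = set (labels (ts' ! i))"
      unfolding labels_child_eq[OF T i] labels_child_eq[OF T' i'] lab[symmetric]
      unfolding T'eq r by (metis (no_types, lifting))
    fix x y assume xy: "x \<in> set (labels (ts ! i))" "y \<in> set (labels (ts ! i))" "x < y"
    have "tree_mult s (Node r ts) y x = tree_mult s T' y x"
      using Node.prems(4) labels_childI[OF i] xy by blast
    then show "tree_mult s (ts ! i) y x = tree_mult s (ts' ! i) y x"
      unfolding T'eq using xy eq
      by (simp add: tree_mult_child[OF T i _ i] tree_mult_child[OF T' i' _ i'])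
  qed
  then show ?case using len r T'eq by (auto intro: nth_equalityI)
qed

text \<open>The largest label becomes the root, and branch \<open>j\<close> is built on the labels
  where row \<open>r\<close> of \<open>f\<close> equals \<open>j\<close>. The label set is arbitrary
  so that the recursion can enter the branches.\<close>

lemma exists_s_tree:
  assumes "finite V"
    and "\<And>x y. \<lbrakk>x \<in> V; y \<in> V; x < y\<rbrakk> \<Longrightarrow> f y x \<le> s y"
    and "\<And>a b c. \<lbrakk>a \<in> V; b \<in> V; c \<in> V; a < b; b < c\<rbrakk> \<Longrightarrow> f c a \<le> f c b"
    and "\<And>a b c. \<lbrakk>a \<in> V; b \<in> V; c \<in> V; a < b; b < c; 0 < f b a\<rbrakk> \<Longrightarrow> f c b \<le> f c a"
  shows "\<exists>T. s_tree s T \<and> set (labels T) = V \<and> (\<forall>x\<in>V. \<forall>y\<in>V. x < y \<longrightarrow> tree_mult s T y x = f y x)"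
  using assms
proof (induction V rule: finite_psubset_induct)
  case (psubset V)
  note le = psubset.prems(1) and mono = psubset.prems(2) and trans = psubset.prems(3)
  show ?case
  proof (cases "V = {}")
    case True
    then show ?thesis by (intro exI[of _ Leaf]) (auto simp: s_tree_def)
  next
    case False
    define r where "r = Max V"
    have r: "r \<in> V" "\<And>x. x \<in> V \<Longrightarrow> x \<le> r" using psubset.hyps False by (auto simp: r_def)
    define W where "W j = {x \<in> V. x < r \<and> f r x = j}" for j
    have "\<exists>T. s_tree s T \<and> set (labels T) = W j \<and>
        (\<forall>x\<in>W j. \<forall>y\<in>W j. x < y \<longrightarrow> tree_mult s T y x = f y x)" for j
    proof (rule psubset.IH)
      show "W j \<subset> V" using r(1) by (auto simp: W_def)
    qed (use le mono trans in \<open>auto simp: W_def\<close>)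
    then obtain g where g: "\<And>j. s_tree s (g j)" "\<And>j. set (labels (g j)) = W j"
      "\<And>j x y. \<lbrakk>x \<in> W j; y \<in> W j; x < y\<rbrakk> \<Longrightarrow> tree_mult s (g j) y x = f y x" by metis
    define ts where "ts = map g [0..<s r + 1]"
    have ts: "length ts = s r + 1" "ts ! j = g j" if "j < s r + 1" for j
      using that by (auto simp: ts_def simp del: upt_Suc)
    have len: "length ts = s r + 1" by (simp add: ts_def)
    have T: "s_tree s (Node r ts)"
      unfolding s_tree_Node
    proof (intro conjI ballI allI impI)
      show "length ts = s r + 1" by (rule len)
      fix t assume "t \<in> set ts"
      then obtain j where "t = g j" by (auto simp: ts_def)
      then show "s_tree s t" "\<And>y. y \<in> set (labels t) \<Longrightarrow> y < r" using g by (auto simp: W_def)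
    next
      fix i j assume "i < length ts" "j < length ts" "i \<noteq> j"
      then show "set (labels (ts ! i)) \<inter> set (labels (ts ! j)) = {}"
        using len by (auto simp: ts g W_def)
    qed
    have child: "f r x < length ts \<and> x \<in> set (labels (ts ! f r x))" if "x \<in> V" "x \<noteq> r" for x
    proof -
      have "x < r" using r(2)[OF that(1)] that(2) by simp
      then have "f r x < s r + 1" using le[OF that(1) r(1)] by simp
      then show ?thesis using len that(1) \<open>x < r\<close> by (auto simp: ts g W_def)
    qed
    have lab: "set (labels (Node r ts)) = V"
    proof (intro equalityI subsetI)
      fix x assume "x \<in> set (labels (Node r ts))"
      then show "x \<in> V"
        by (cases rule: labels_Node_cases) (use len r(1) in \<open>auto simp: ts g W_def\<close>)
    next
      fix x assume "x \<in> V"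
      then show "x \<in> set (labels (Node r ts))"
        using child[of x] labels_childI[of "f r x" ts x r] by (cases "x = r") auto
    qed
    have "tree_mult s (Node r ts) y x = f y x" if xy: "x \<in> V" "y \<in> V" "x < y" for x y
    proof -
      have "x \<noteq> r" using r(2)[OF xy(2)] xy(3) by auto
      note x = child[OF xy(1) this]
      show ?thesis
      proof (cases "y = r")
        case True
        then show ?thesis using tree_mult_root[OF T] x by blast
      next
        case False
        note y = child[OF xy(2) False]
        have yr: "y < r" using r(2)[OF xy(2)] False by simp
        have lr: "f r x \<le> f r y" using mono[OF xy(1,2) r(1) xy(3) yr] .
        have *: "tree_mult s (Node r ts) y x = (if f r x < f r y then 0
            else if f r y < f r x then s y else tree_mult s (ts ! f r y) y x)"
          using tree_mult_child[OF T] x y by blast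
        show ?thesis
        proof (cases "f r x = f r y")
          case True
          have "y \<in> W (f r y)" "x \<in> W (f r y)"
            using x y len ts(2)[of "f r y"] g(2)[of "f r y"] unfolding True by simp_all
          then have "tree_mult s (ts ! f r y) y x = f y x"
            using y len g(3)[of x "f r y" y] xy(3) by (simp add: ts)
          then show ?thesis using * True by simp
        next
          case False
          \<comment> \<open>In different branches, monotonicity of row \<open>r\<close> puts
            \<open>x\<close> to the left of \<open>y\<close>, where the tree has multiplicity 0. A
            positive \<open>f y x\<close> would by transitivity equate row \<open>r\<close> at
            \<open>x\<close> and \<open>y\<close>.\<close>
          moreover have "f y x = 0" using trans[OF xy(1,2) r(1) xy(3) yr] False lr by auto
          ultimately show ?thesis using * lr by simp
        qed
      qed
    qed
    then show ?thesis using T lab by blast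
  qed
qed

section \<open>Children of a vertex read off the multiplicities\<close>

lemma child_of_labels:
  assumes "child_of T a b"
  shows "a \<in> set (labels T)" "b \<in> set (labels T)"
proof -
  obtain ts us where *: "Node b ts \<in> subtrees T" "Node a us \<in> set ts"
    using assms by (auto simp: child_of_def)
  from labels_subtree[OF *(1)] show "b \<in> set (labels T)" by simp
  have "a \<in> set (labels (Node b ts))" using *(2) by force
  then show "a \<in> set (labels T)" using labels_subtree[OF *(1)] by blast
qed

lemma child_of_Node:
  "child_of (Node r ts) a b \<longleftrightarrow> b = r \<and> (\<exists>us. Node a us \<in> set ts) \<or> (\<exists>t\<in>set ts. child_of t a b)"
  unfolding child_of_def by auto

text \<open>If \<open>b\<close> is the root, \<open>a\<close> is a child exactly when it is the
  largest label of its branch; row monotonicity turns lying in another branch into the strict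
  inequality. If \<open>b\<close> lies in branch \<open>k\<close>, the row of the root forces
  \<open>a\<close> into the same branch, and labels outside that branch satisfy both conditions
  automatically, so the claim reduces to branch \<open>k\<close>.\<close>

lemma child_of_iff:
  assumes "s_tree s T" "a \<in> set (labels T)" "b \<in> set (labels T)" "a < b" "tree_mult s T b a < s b"
    and "\<And>x y z. \<lbrakk>x \<in> set (labels T); y \<in> set (labels T); z \<in> set (labels T); x < y; y < z\<rbrakk> \<Longrightarrow>
      tree_mult s T z x \<le> tree_mult s T z y"
  shows "child_of T a b \<longleftrightarrow>
     (\<forall>c\<in>set (labels T). b < c \<longrightarrow> tree_mult s T c a = tree_mult s T c b) \<and>
     (\<forall>e\<in>set (labels T). a < e \<and> e < b \<longrightarrow> tree_mult s T b a < tree_mult s T b e)"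
  using assms
proof (induction T)
  case (Node r ts)
  note T = Node.prems(1)
  let ?T = "Node r ts"
  note le = labels_le_root[OF T]
  note mono = Node.prems(6)
  have root: "r \<in> set (labels ?T)" by simp
  have "a \<noteq> r" using le[OF Node.prems(3)] Node.prems(4) by simp
  then obtain i where i: "i < length ts" "a \<in> set (labels (ts ! i))"
    using labels_Node_cases[OF Node.prems(2)] by blast
  note mr = tree_mult_root[OF T]
  from Node.prems(3) show ?case
  proof (cases rule: labels_Node_cases)
    case 1
    have "child_of ?T a b \<longleftrightarrow> (\<exists>us. ts ! i = Node a us)"
    proof
      assume "child_of ?T a b"
      moreover have "\<not> child_of t a r" if "t \<in> set ts" for t
        using that T child_of_labels unfolding s_tree_Node by blast
      ultimately obtain us where "Node a us \<in> set ts" using 1 unfolding child_of_Node by blast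
      then obtain j where "j < length ts" "ts ! j = Node a us" by (auto simp: in_set_conv_nth)
      then show "\<exists>us. ts ! i = Node a us" using s_tree_NodeD(4)[OF T i(1) _ i(2)] by force
    next
      assume "\<exists>us. ts ! i = Node a us"
      then show "child_of ?T a b" using 1 nth_mem[OF i(1)] unfolding child_of_Node by metis
    qed
    also have "\<dots> \<longleftrightarrow> (\<forall>e\<in>set (labels ?T). a < e \<and> e < b \<longrightarrow> tree_mult s ?T b a < tree_mult s ?T b e)"
    proof
      assume "\<exists>us. ts ! i = Node a us"
      then obtain us where us: "ts ! i = Node a us" by blast
      show "\<forall>e\<in>set (labels ?T). a < e \<and> e < b \<longrightarrow> tree_mult s ?T b a < tree_mult s ?T b e"
      proof (intro ballI impI)
        fix e assume e: "e \<in> set (labels ?T)" "a < e \<and> e < b"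
        then obtain j where j: "j < length ts" "e \<in> set (labels (ts ! j))"
          using labels_Node_cases[OF e(1)] 1 by blast
        have "i \<noteq> j"
          using labels_le_root[of s a us e] s_tree_NodeD(2)[OF T i(1)] us j e(2) by auto
        moreover have "i \<le> j"
          using mono[OF Node.prems(2) e(1) root] e(2) mr[OF i] mr[OF j] 1 by simp
        ultimately show "tree_mult s ?T b a < tree_mult s ?T b e" using mr[OF i] mr[OF j] 1 by simp
      qed
    next
      assume R: "\<forall>e\<in>set (labels ?T). a < e \<and> e < b \<longrightarrow> tree_mult s ?T b a < tree_mult s ?T b e"
      obtain e us where eq: "ts ! i = Node e us" using i(2) by (cases "ts ! i") auto
      then have e: "e \<in> set (labels (ts ! i))" by simp
      have "\<not> a < e"
      proof
        assume "a < e"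
        then have "tree_mult s ?T b a < tree_mult s ?T b e"
          using R labels_childI[OF i(1) e] s_tree_NodeD(3)[OF T i(1) e] 1 by blast
        then show False using mr[OF i] mr[OF i(1) e] 1 by simp
      qed
      moreover have "a \<le> e"
        using labels_le_root[of s e us a] s_tree_NodeD(2)[OF T i(1)] eq i(2) by simp
      ultimately show "\<exists>us. ts ! i = Node a us" using eq by simp
    qed
    finally have "child_of ?T a b \<longleftrightarrow>
      (\<forall>e\<in>set (labels ?T). a < e \<and> e < b \<longrightarrow> tree_mult s ?T b a < tree_mult s ?T b e)" .
    moreover have "\<not> b < c" if "c \<in> set (labels ?T)" for c using le[OF that] 1 by simp
    ultimately show ?thesis by blast
  next
    case (2 k)
    note mk = tree_mult_child[OF T _ _ 2]
    have br: "b < r" using s_tree_NodeD(3)[OF T 2] .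
    have child: "child_of ?T a b \<longleftrightarrow> child_of (ts ! k) a b"
    proof -
      have "t = ts ! k" if "t \<in> set ts" "child_of t a b" for t
        using that s_tree_NodeD(4)[OF T _ 2(1) _ 2(2)] child_of_labels(2)[OF that(2)]
        by (metis in_set_conv_nth)
      then show ?thesis unfolding child_of_Node using 2(1) br by (auto dest: nth_mem)
    qed
    show ?thesis
    proof (cases "i = k")
      case False
      then have "\<not> child_of (ts ! k) a b"
        using child_of_labels(1) s_tree_NodeD(4)[OF T i(1) 2(1) i(2)] by blast
      moreover have "tree_mult s ?T r a \<noteq> tree_mult s ?T r b" using mr[OF i] mr[OF 2] False by simp
      ultimately show ?thesis using child root br by blast
    next
      case True
      note a = i[unfolded True]
      have in_k: "tree_mult s ?T y x = tree_mult s (ts ! k) y x"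
        if "x \<in> set (labels (ts ! k))" "y \<in> set (labels (ts ! k))" for x y
        using tree_mult_child[OF T 2(1) that(1) 2(1) that(2)] by simp
      have lab: "x \<in> set (labels ?T)" if "x \<in> set (labels (ts ! k))" for x
        using labels_childI[OF 2(1) that] .
      have IH: "child_of (ts ! k) a b \<longleftrightarrow>
          (\<forall>c\<in>set (labels (ts ! k)). b < c \<longrightarrow> tree_mult s (ts ! k) c a = tree_mult s (ts ! k) c b) \<and>
          (\<forall>e\<in>set (labels (ts ! k)). a < e \<and> e < b \<longrightarrow> tree_mult s (ts ! k) b a < tree_mult s (ts ! k) b e)"
      proof (rule Node.IH)
        show "ts ! k \<in> set ts" "s_tree s (ts ! k)" using 2 s_tree_NodeD(2)[OF T] by auto
        show "tree_mult s (ts ! k) b a < s b" using Node.prems(5) in_k[OF a(2) 2(2)] by simp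
        show "tree_mult s (ts ! k) z x \<le> tree_mult s (ts ! k) z y"
          if "x \<in> set (labels (ts ! k))" "y \<in> set (labels (ts ! k))" "z \<in> set (labels (ts ! k))"
            "x < y" "y < z" for x y z
          using mono[OF lab lab lab] that in_k by metis
      qed (use a 2 Node.prems(4) in auto)
      have C: "tree_mult s ?T c a = tree_mult s ?T c b"
        if c: "c \<in> set (labels ?T)" "c \<notin> set (labels (ts ! k))" for c
        using c(1)
      proof (cases rule: labels_Node_cases)
        case 1
        then show ?thesis using mr[OF a] mr[OF 2] by simp
      next
        case (2 j)
        then have "j \<noteq> k" using c(2) by auto
        then show ?thesis
          using tree_mult_child[OF T a 2] tree_mult_child[OF T \<open>k < length ts\<close> \<open>b \<in> set (labels (ts ! k))\<close> 2]
          by auto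
      qed
      \<comment> \<open>Here the strict bound \<open>tree_mult s T b a < s b\<close> enters: by
        monotonicity \<open>e\<close> lies in a branch to the right of \<open>b\<close>, where its
        multiplicity is the full \<open>s b\<close>.\<close>
      have E: "tree_mult s ?T b a < tree_mult s ?T b e"
        if e: "e \<in> set (labels ?T)" "e \<notin> set (labels (ts ! k))" "a < e" "e < b" for e
      proof -
        obtain j where j: "j < length ts" "e \<in> set (labels (ts ! j))"
          using labels_Node_cases[OF e(1)] e(4) br by auto
        have "k \<noteq> j" using e(2) j by auto
        moreover have "k \<le> j"
          using mono[OF Node.prems(2) e(1) root e(3)] e(4) br mr[OF a] mr[OF j] by simp
        ultimately show ?thesis using mk[OF j] Node.prems(5) by simp
      qed
      have "(\<forall>c\<in>set (labels ?T). b < c \<longrightarrow> tree_mult s ?T c a = tree_mult s ?T c b) \<longleftrightarrow>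
          (\<forall>c\<in>set (labels (ts ! k)). b < c \<longrightarrow> tree_mult s (ts ! k) c a = tree_mult s (ts ! k) c b)"
        using C in_k[OF a(2)] in_k[OF 2(2)] lab by metis
      moreover have "(\<forall>e\<in>set (labels ?T). a < e \<and> e < b \<longrightarrow> tree_mult s ?T b a < tree_mult s ?T b e) \<longleftrightarrow>
          (\<forall>e\<in>set (labels (ts ! k)). a < e \<and> e < b \<longrightarrow> tree_mult s (ts ! k) b a < tree_mult s (ts ! k) b e)"
        using E in_k[OF a(2) 2(2)] in_k[OF _ 2(2)] lab by metis
      ultimately show ?thesis using child IH by simp
    qed
  qed
qed simp

section \<open>Tamari trees correspond to Tamari multi-inversion sets\<close>

lemma tamari_mis_tree_inv:
  assumes "tamari_tree n s T"
  shows "tamari_mis n s (tree_inv n s T)"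
proof -
  have T: "s_tree s T" "set (labels T) = {1..n}"
    and mono: "\<And>a b c. \<lbrakk>1 \<le> a; a < b; b < c; c \<le> n\<rbrakk> \<Longrightarrow> tree_mult s T c a \<le> tree_mult s T c b"
    using assms by (auto simp: tamari_tree_def decreasing_tree_iff)
  show ?thesis
    unfolding tree_inv_eq
  proof (rule tamari_mis_of)
    show "tree_mult s T y x \<le> s y" if "1 \<le> x" "x < y" "y \<le> n" for y x
      using tree_mult_le[OF T(1)] T(2) that by simp
    show "tree_mult s T c b \<le> tree_mult s T c a"
      if "1 \<le> a" "a < b" "b < c" "c \<le> n" "0 < tree_mult s T b a" for a b c
      using tree_mult_transitive[OF T(1)] T(2) that by simp
  qed (rule mono)
qed

lemma tree_inv_inj:
  assumes "tamari_tree n s T" "tamari_tree n s T'" "tree_inv n s T = tree_inv n s T'"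
  shows "T = T'"
proof (rule s_tree_eqI)
  show "s_tree s T" "s_tree s T'" and eq: "set (labels T) = set (labels T')"
    using assms by (auto simp: tamari_tree_def decreasing_tree_iff)
  fix x y assume "x \<in> set (labels T)" "y \<in> set (labels T)" "x < y"
  then have "1 \<le> x" "x < y" "y \<le> n"
    using assms(1) by (auto simp: tamari_tree_def decreasing_tree_iff)
  then show "tree_mult s T y x = tree_mult s T' y x"
    using assms(3) count_tree_inv by metis
qed

lemma exists_tamari_tree:
  assumes "tamari_mis n s I"
  obtains T where "tamari_tree n s T" "tree_inv n s T = I"
proof -
  note tam = tamari_misD[OF assms]
  have "\<exists>T. s_tree s T \<and> set (labels T) = {1..n} \<and>
    (\<forall>x\<in>{1..n}. \<forall>y\<in>{1..n}. x < y \<longrightarrow> tree_mult s T y x = count I (y, x))"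
  proof (rule exists_s_tree)
    show "count I (y, x) \<le> s y" for x y by (rule tam(4))
    show "count I (c, a) \<le> count I (c, b)"
      if "a \<in> {1..n}" "b \<in> {1..n}" "c \<in> {1..n}" "a < b" "b < c" for a b c
      using tam(6) that by simp
    show "count I (c, b) \<le> count I (c, a)"
      if "a \<in> {1..n}" "b \<in> {1..n}" "c \<in> {1..n}" "a < b" "b < c" "0 < count I (b, a)" for a b c
      using tam(7)[of a b c] that by simp
  qed simp
  then obtain T where T: "s_tree s T" "set (labels T) = {1..n}"
    and m: "\<And>x y. \<lbrakk>1 \<le> x; x < y; y \<le> n\<rbrakk> \<Longrightarrow> tree_mult s T y x = count I (y, x)"
    by auto
  have "tamari_tree n s T"
    using T tam(6) by (auto simp: tamari_tree_def decreasing_tree_iff m)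
  moreover have "tree_inv n s T = I"
  proof (rule multiset_eqI)
    fix p :: "nat \<times> nat"
    obtain y x where p: "p = (y, x)" by fastforce
    show "count (tree_inv n s T) p = count I p"
      using tam(5)[of y x] m[of x y] unfolding p tree_inv_eq count_mis_of by force
  qed
  ultimately show thesis using that by blast
qed

lemma tamari_ascent_iff:
  assumes "tamari_tree n s T"
  shows "tamari_ascent s T a b \<longleftrightarrow> mis_ascent n s (tree_inv n s T) a b"
proof (cases "1 \<le> a \<and> a < b \<and> b \<le> n")
  case False
  moreover have "\<not> child_of T a b" if "\<not> (1 \<le> a \<and> b \<le> n)"
    using child_of_labels[of T a b] assms that by (auto simp: tamari_tree_def decreasing_tree_iff)
  ultimately show ?thesis by (auto simp: tamari_ascent_def mis_ascent_def)
next
  case True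
  have T: "s_tree s T" "set (labels T) = {1..n}"
    and mono: "\<And>a b c. \<lbrakk>1 \<le> a; a < b; b < c; c \<le> n\<rbrakk> \<Longrightarrow> tree_mult s T c a \<le> tree_mult s T c b"
    using assms by (auto simp: tamari_tree_def decreasing_tree_iff)
  have "child_of T a b \<longleftrightarrow>
     (\<forall>c\<in>{1..n}. b < c \<longrightarrow> tree_mult s T c a = tree_mult s T c b) \<and>
     (\<forall>e\<in>{1..n}. a < e \<and> e < b \<longrightarrow> tree_mult s T b a < tree_mult s T b e)"
    if "tree_mult s T b a < s b"
    using child_of_iff[OF T(1) _ _ _ that] mono True unfolding T(2) by simp
  moreover have "(\<forall>c\<in>{1..n}. b < c \<longrightarrow> tree_mult s T c a = tree_mult s T c b) \<longleftrightarrow>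
     (\<forall>c. b < c \<and> c \<le> n \<longrightarrow> count (tree_inv n s T) (c, a) = count (tree_inv n s T) (c, b))"
    using True by (auto simp: tree_inv_eq count_mis_of)
  moreover have "(\<forall>e\<in>{1..n}. a < e \<and> e < b \<longrightarrow> tree_mult s T b a < tree_mult s T b e) \<longleftrightarrow>
     (\<forall>e. a < e \<and> e < b \<longrightarrow> count (tree_inv n s T) (b, a) < count (tree_inv n s T) (b, e))"
    using True by (auto simp: tree_inv_eq count_mis_of)
  ultimately show ?thesis
    using True by (auto simp: tamari_ascent_def mis_ascent_def count_tree_inv)
qed

text \<open>The definite description in \<open>tamari_rotation\<close> is met by the tree of
  \<open>mis_rotation\<close> and, since inversion sets determine Tamari trees, by no other.\<close>

lemma tree_inv_tamari_rotation:
  assumes "tamari_tree n s T" "tamari_ascent s T a b"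
  shows "tamari_tree n s (tamari_rotation n s T a b)"
    and "tree_inv n s (tamari_rotation n s T a b) = mis_rotation n (tree_inv n s T) a b"
proof -
  note I = tamari_mis_tree_inv[OF assms(1)]
  note ab = assms(2)[unfolded tamari_ascent_iff[OF assms(1)]]
  obtain Z where Z: "tamari_tree n s Z" "tree_inv n s Z = mis_rotation n (tree_inv n s T) a b"
    using exists_tamari_tree[OF tamari_mis_rotation[OF I ab]] .
  have "tamari_rotation n s T a b = Z"
    unfolding tamari_rotation_def mis_rotation_eq_trans_closure[OF I ab]
    using Z tree_inv_inj by (intro the_equality) auto
  then show "tamari_tree n s (tamari_rotation n s T a b)"
    "tree_inv n s (tamari_rotation n s T a b) = mis_rotation n (tree_inv n s T) a b"
    using Z by auto
qed

lemma tamari_added_eq: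
  assumes "tamari_tree n s T" "tamari_ascent s T a b"
  shows "tamari_added n s T a b = mis_added (tree_inv n s T) a b"
proof -
  note I = tamari_mis_tree_inv[OF assms(1)]
  note ab = assms(2)[unfolded tamari_ascent_iff[OF assms(1)]]
  have "count (tree_inv n s T) p < count (mis_rotation n (tree_inv n s T) a b) p \<longleftrightarrow>
      p \<in> mis_added (tree_inv n s T) a b" for p
    using count_mis_rotation[OF I ab, of "fst p" "snd p"] by simp
  then show ?thesis
    unfolding tamari_added_def tree_inv_tamari_rotation(2)[OF assms] by blast
qed

lemma finite_tamari_trees: "finite {T. tamari_tree n s T}"
proof (rule finite_imageD)
  \<comment> \<open>The union over all rows provides one finite codomain common to all
    pairs.\<close>
  let ?F = "{f :: nat \<times> nat \<Rightarrow> nat.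
    \<forall>p. (p \<in> inversion_pairs n \<longrightarrow> f p \<in> (\<Union>y\<le>n. {..s y})) \<and> (p \<notin> inversion_pairs n \<longrightarrow> f p = 0)}"
  show "finite ((\<lambda>T. count (tree_inv n s T)) ` {T. tamari_tree n s T})"
  proof (rule finite_subset)
    show "(\<lambda>T. count (tree_inv n s T)) ` {T. tamari_tree n s T} \<subseteq> ?F"
    proof clarify
      fix T y x assume "tamari_tree n s T"
      note tam = tamari_misD(4,5)[OF tamari_mis_tree_inv[OF this], of y x]
      show "((y, x) \<in> inversion_pairs n \<longrightarrow> count (tree_inv n s T) (y, x) \<in> (\<Union>y\<le>n. {..s y})) \<and>
          ((y, x) \<notin> inversion_pairs n \<longrightarrow> count (tree_inv n s T) (y, x) = 0)"
        using tam by (auto simp: inversion_pairs_def)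
    qed
    show "finite ?F"
      by (rule finite_set_of_finite_funs) (simp_all add: finite_inversion_pairs)
  qed
  show "inj_on (\<lambda>T. count (tree_inv n s T)) {T. tamari_tree n s T}"
    by (rule inj_onI) (auto intro: tree_inv_inj simp: count_inject)
qed

section \<open>Order complexes of finite posets\<close>

lemma homotopic_with_TrueI:
  assumes "continuous_map (prod_topology (top_of_set {0..1::real}) X) Y h"
    and "\<And>x. x \<in> topspace X \<Longrightarrow> h (0, x) = f x" "\<And>x. x \<in> topspace X \<Longrightarrow> h (1, x) = g x"
  shows "homotopic_with (\<lambda>x. True) X Y f g"
  using assms by (subst homotopic_with) auto

lemma continuous_map_interval_fst:
  "continuous_map (prod_topology (top_of_set {0..1::real}) X) euclideanreal fst"
  by (metis continuous_map_fst continuous_map_into_fulltopology)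

lemma continuous_map_interval_snd:
  assumes "continuous_map X Y f"
  shows "continuous_map (prod_topology (top_of_set {0..1::real}) X) Y (\<lambda>z. f (snd z))"
  using continuous_map_compose[OF continuous_map_snd assms] by (simp add: o_def)

lemma continuous_map_nsphere_iff:
  "continuous_map X (nsphere q) f \<longleftrightarrow>
     (\<forall>i. continuous_map X euclideanreal (\<lambda>x. f x i)) \<and> f \<in> topspace X \<rightarrow> topspace (nsphere q)"
  unfolding nsphere continuous_map_in_subtopology continuous_map_componentwise_UNIV by simp

lemma topspace_nsphere_iff:
  "x \<in> topspace (nsphere q) \<longleftrightarrow> (\<Sum>i\<le>q. (x i)\<^sup>2) = 1 \<and> (\<forall>i>q. x i = 0)"
  by (simp add: nsphere)

definition normalize_sphere :: "nat \<Rightarrow> (nat \<Rightarrow> real) \<Rightarrow> nat \<Rightarrow> real" where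
  "normalize_sphere q d = (\<lambda>i. if i \<le> q then d i / sqrt (\<Sum>j\<le>q. (d j)\<^sup>2) else 0)"

lemma sum_squares_pos:
  fixes q :: nat
  assumes "i \<le> q" "d i \<noteq> (0::real)"
  shows "0 < (\<Sum>j\<le>q. (d j)\<^sup>2)"
  using assms by (intro sum_pos2[of _ i]) auto

lemma continuous_map_normalize_sphere:
  assumes "\<And>i. i \<le> q \<Longrightarrow> continuous_map X euclideanreal (\<lambda>x. d x i)"
    and nz: "\<And>x. x \<in> topspace X \<Longrightarrow> \<exists>i\<le>q. d x i \<noteq> 0"
  shows "continuous_map X (nsphere q) (\<lambda>x. normalize_sphere q (d x))"
  unfolding continuous_map_nsphere_iff
proof (intro conjI allI)
  have pos: "0 < (\<Sum>j\<le>q. (d x j)\<^sup>2)" if "x \<in> topspace X" for x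
    using nz[OF that] sum_squares_pos[of _ q "d x"] by blast
  have "continuous_map X euclideanreal (\<lambda>x. d x i / sqrt (\<Sum>j\<le>q. (d x j)\<^sup>2))" if "i \<le> q" for i
  proof (intro continuous_intros assms that)
    show "sqrt (\<Sum>j\<le>q. (d x j)\<^sup>2) \<noteq> 0" if "x \<in> topspace X" for x using pos[OF that] by simp
  qed simp_all
  then show "continuous_map X euclideanreal (\<lambda>x. normalize_sphere q (d x) i)" for i
    by (cases "i \<le> q") (simp_all add: normalize_sphere_def)
  show "(\<lambda>x. normalize_sphere q (d x)) \<in> topspace X \<rightarrow> topspace (nsphere q)"
  proof
    fix x assume "x \<in> topspace X"
    have "(\<Sum>i\<le>q. (normalize_sphere q (d x) i)\<^sup>2) = (\<Sum>i\<le>q. (d x i)\<^sup>2 / (\<Sum>j\<le>q. (d x j)\<^sup>2))"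
      by (intro sum.cong) (simp_all add: normalize_sphere_def power_divide sum_nonneg)
    also have "\<dots> = 1" using pos[OF \<open>x \<in> topspace X\<close>] by (simp flip: sum_divide_distrib)
    finally show "normalize_sphere q (d x) \<in> topspace (nsphere q)"
      by (simp add: topspace_nsphere_iff) (simp add: normalize_sphere_def)
  qed
qed

lemma normalize_sphere_id: "x \<in> topspace (nsphere q) \<Longrightarrow> normalize_sphere q x = x"
  by (auto simp: topspace_nsphere_iff normalize_sphere_def)

section \<open>The realization of a finite order complex\<close>

text \<open>Total mass one excludes the empty support, and finiteness of \<open>P\<close> lets the
  sum run over the fixed set \<open>P\<close> instead of the varying support. All later mass
  computations become linear.\<close>

lemma topspace_order_complex:
  fixes le :: "'a \<Rightarrow> 'a \<Rightarrow> bool"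
  assumes "finite P"
  shows "g \<in> topspace (geometric_realization (order_complex le P)) \<longleftrightarrow>
    (\<forall>v. 0 \<le> g v) \<and> (\<forall>v. v \<notin> P \<longrightarrow> g v = 0) \<and> sum g P = 1 \<and>
    (\<forall>v w. g v \<noteq> 0 \<and> g w \<noteq> 0 \<longrightarrow> le v w \<or> le w v)"
proof -
  have "sum g {v. g v \<noteq> 0} = sum g P" if "{v. g v \<noteq> 0} \<subseteq> P"
    using that assms by (intro sum.mono_neutral_left) auto
  moreover have "{v. g v \<noteq> 0} \<noteq> {}" if "sum g P = 1"
    using that by (metis (mono_tags, lifting) empty_Collect_eq sum.neutral zero_neq_one)
  moreover have "finite {v. g v \<noteq> 0}" if "{v. g v \<noteq> 0} \<subseteq> P"
    using that assms by (rule finite_subset)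
  ultimately show ?thesis
    unfolding geometric_realization_def order_complex_def chain_def by auto blast+
qed

lemma continuous_map_realization_iff:
  "continuous_map X (geometric_realization K) f \<longleftrightarrow>
     (\<forall>v. continuous_map X euclideanreal (\<lambda>x. f x v)) \<and>
     f \<in> topspace X \<rightarrow> topspace (geometric_realization K)"
  unfolding geometric_realization_def continuous_map_in_subtopology continuous_map_componentwise_UNIV
  by simp

lemma continuous_map_realization_proj:
  "continuous_map (geometric_realization K) euclideanreal (\<lambda>g. g v)"
  unfolding geometric_realization_def
  by (blast intro: continuous_map_from_subtopology[OF continuous_map_product_projection])

text \<open>The segment from \<open>F x\<close> to \<open>G x\<close> stays in the realization when
  the union of the two supports is a chain. Only mixed pairs are assumed comparable, since each
  support is a chain already.\<close>

lemma homotopic_realization_linear: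
  fixes le :: "'a \<Rightarrow> 'a \<Rightarrow> bool"
  assumes P: "finite P"
    and F: "continuous_map X (geometric_realization (order_complex le P)) F"
    and G: "continuous_map X (geometric_realization (order_complex le P)) G"
    and chain: "\<And>x v w. \<lbrakk>x \<in> topspace X; F x v \<noteq> 0; G x w \<noteq> 0\<rbrakk> \<Longrightarrow> le v w \<or> le w v"
  shows "homotopic_with (\<lambda>x. True) X (geometric_realization (order_complex le P)) F G"
proof (rule homotopic_with_TrueI)
  let ?h = "\<lambda>z v. (1 - fst z) * F (snd z) v + fst z * G (snd z) v"
  let ?R = "geometric_realization (order_complex le P)"
  have cont: "continuous_map (prod_topology (top_of_set {0..1}) X) euclideanreal (\<lambda>z. ?h z v)" for v
    using F G unfolding continuous_map_realization_iff
    by (intro continuous_intros continuous_map_interval_fst continuous_map_interval_snd) auto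
  show "continuous_map (prod_topology (top_of_set {0..1}) X) ?R ?h"
    unfolding continuous_map_realization_iff
  proof (intro conjI allI cont funcsetI)
    fix z assume z: "z \<in> topspace (prod_topology (top_of_set {0..1::real}) X)"
    obtain t x where tx: "z = (t, x)" by fastforce
    have t: "0 \<le> t" "t \<le> 1" and x: "x \<in> topspace X" using z tx by auto
    have Fx: "F x \<in> topspace ?R" and Gx: "G x \<in> topspace ?R"
      using F G x by (auto simp: continuous_map_realization_iff)
    note Fx = Fx[unfolded topspace_order_complex[OF P]]
    note Gx = Gx[unfolded topspace_order_complex[OF P]]
    have "sum (?h z) P = (1 - t) * sum (F x) P + t * sum (G x) P"
      by (simp add: tx sum.distrib sum_distrib_left)
    then have "sum (?h z) P = 1" using Fx Gx by simp
    moreover have "le v w \<or> le w v" if "?h z v \<noteq> 0" "?h z w \<noteq> 0" for v w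
    proof -
      have "F x v \<noteq> 0 \<or> G x v \<noteq> 0" "F x w \<noteq> 0 \<or> G x w \<noteq> 0" using that by (auto simp: tx)
      then show ?thesis using Fx Gx chain[OF x] by blast
    qed
    moreover have "0 \<le> ?h z v" for v using t Fx Gx by (simp add: tx)
    moreover have "?h z v = 0" if "v \<notin> P" for v using that Fx Gx by (simp add: tx)
    ultimately show "?h z \<in> topspace ?R" unfolding topspace_order_complex[OF P] by blast
  qed
qed simp_all

text \<open>The simplicial map induced by \<open>r\<close>, in barycentric coordinates.\<close>

definition push_forward :: "('a \<Rightarrow> 'a) \<Rightarrow> 'a set \<Rightarrow> ('a \<Rightarrow> real) \<Rightarrow> 'a \<Rightarrow> real" where
  "push_forward r P g v = sum g {w \<in> P. r w = v}"

locale finite_poset =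
  fixes P :: "'a set" and le :: "'a \<Rightarrow> 'a \<Rightarrow> bool"
  assumes finite_P: "finite P"
    and le_refl: "v \<in> P \<Longrightarrow> le v v"
    and le_antisym: "\<lbrakk>v \<in> P; w \<in> P; le v w; le w v\<rbrakk> \<Longrightarrow> v = w"
    and le_trans: "\<lbrakk>u \<in> P; v \<in> P; w \<in> P; le u v; le v w\<rbrakk> \<Longrightarrow> le u w"
begin

abbreviation "realization \<equiv> geometric_realization (order_complex le P)"

lemmas in_realization = topspace_order_complex[OF finite_P, of _ le]

lemma realizationD:
  assumes "g \<in> topspace realization"
  shows "0 \<le> g v" "v \<notin> P \<Longrightarrow> g v = 0" "g v \<noteq> 0 \<Longrightarrow> v \<in> P" "sum g P = 1"
    "\<lbrakk>g v \<noteq> 0; g w \<noteq> 0\<rbrakk> \<Longrightarrow> le v w \<or> le w v"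
  using assms unfolding in_realization by auto

lemma realization_obtain:
  assumes "g \<in> topspace realization"
  obtains v where "v \<in> P" "0 < g v"
proof -
  have "\<exists>v\<in>P. g v \<noteq> 0"
  proof (rule ccontr)
    assume "\<not> (\<exists>v\<in>P. g v \<noteq> 0)"
    then have "sum g P = 0" by (intro sum.neutral) simp
    then show False using realizationD(4)[OF assms] by simp
  qed
  then show thesis using that realizationD(1)[OF assms] by (metis order_le_less)
qed

text \<open>For a chain \<open>C\<close>, the union of \<open>C\<close> and \<open>r ` C\<close> need not be a chain, so the straight-line
  homotopy is not available. Instead, at time \<open>t\<close> the lowest \<open>t\<close> units of mass have been moved
  by \<open>r\<close>: \<open>moved t g w\<close> is the part of the mass of \<open>w\<close> already moved.\<close>

definition moved :: "real \<Rightarrow> ('a \<Rightarrow> real) \<Rightarrow> 'a \<Rightarrow> real" where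
  "moved t g w = max 0 (min (g w) (t - sum g {u \<in> P. le u w \<and> u \<noteq> w}))"

lemma homotopic_id_push_forward:
  assumes r: "\<And>v. v \<in> P \<Longrightarrow> r v \<in> P" "\<And>v. v \<in> P \<Longrightarrow> le (r v) v"
    and mono: "\<And>v w. \<lbrakk>v \<in> P; w \<in> P; le v w\<rbrakk> \<Longrightarrow> le (r v) (r w)"
  shows "homotopic_with (\<lambda>x. True) realization realization id (push_forward r P)"
proof (rule homotopic_with_TrueI)
  let ?h = "\<lambda>z v. sum (moved (fst z) (snd z)) {w \<in> P. r w = v} + (snd z v - moved (fst z) (snd z) v)"
  have fin: "finite {w \<in> P. Q w}" for Q using finite_P by simp
  have cont_moved: "continuous_map (prod_topology (top_of_set {0..1}) realization) euclideanreal
      (\<lambda>z. moved (fst z) (snd z) v)" for v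
    unfolding moved_def
    by (intro continuous_intros continuous_map_interval_fst fin
        continuous_map_interval_snd[OF continuous_map_realization_proj])
  have cont: "continuous_map (prod_topology (top_of_set {0..1}) realization) euclideanreal
      (\<lambda>z. ?h z v)" for v
    by (intro continuous_intros cont_moved fin
        continuous_map_interval_snd[OF continuous_map_realization_proj])
  show "continuous_map (prod_topology (top_of_set {0..1}) realization) realization ?h"
    unfolding continuous_map_realization_iff
  proof (intro conjI allI cont funcsetI)
    fix z assume z: "z \<in> topspace (prod_topology (top_of_set {0..1::real}) realization)"
    obtain t g where tg: "z = (t, g)" by fastforce
    have g: "g \<in> topspace realization" using z tg by auto
    note gD = realizationD[OF g]
    have m0: "0 \<le> moved t g v" and mg: "moved t g v \<le> g v" for v
      using gD(1)[of v] by (auto simp: moved_def)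
    have mz: "moved t g v = 0" if "g v = 0" for v using m0[of v] mg[of v] that by simp
    have "sum (?h z) P = (\<Sum>v\<in>P. sum (moved t g) {w \<in> P. r w = v}) + sum g P - sum (moved t g) P"
      by (simp add: tg sum.distrib sum_subtractf)
    also have "(\<Sum>v\<in>P. sum (moved t g) {w \<in> P. r w = v}) = sum (moved t g) P"
      using r(1) by (intro sum.group finite_P) auto
    finally have "sum (?h z) P = 1" using gD(4) by simp
    moreover have "0 \<le> ?h z v" for v
      using m0 mg[of v] by (simp add: tg add_nonneg_nonneg sum_nonneg)
    moreover have "?h z v = 0" if "v \<notin> P" for v
    proof -
      have "{w \<in> P. r w = v} = {}" using that r(1) by auto
      then show ?thesis using gD(2)[OF that] mz[of v] by (simp only: tg fst_conv snd_conv sum.empty)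
    qed
    moreover have "le v v' \<or> le v' v" if nz: "?h z v \<noteq> 0" "?h z v' \<noteq> 0" for v v'
    proof -
      define A where "A v \<longleftrightarrow> (\<exists>w\<in>P. v = r w \<and> moved t g w > 0)" for v
      define B where "B v \<longleftrightarrow> g v > moved t g v" for v
      have AB: "A v \<or> B v" if "?h z v \<noteq> 0" for v
      proof (rule ccontr)
        assume no: "\<not> (A v \<or> B v)"
        have "moved t g w = 0" if "w \<in> P" "r w = v" for w
        proof (rule ccontr)
          assume "moved t g w \<noteq> 0"
          then have "0 < moved t g w" using m0[of w] by simp
          then show False using that no unfolding A_def by blast
        qed
        then have "sum (moved t g) {w \<in> P. r w = v} = 0" by (intro sum.neutral) blast
        moreover have "g v = moved t g v" using no mg[of v] unfolding B_def by simp
        ultimately show False using that by (simp add: tg)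
      qed
      have Aw: "g w \<noteq> 0" if "moved t g w > 0" for w using that mz by force
      have BB: "g v \<noteq> 0" if "B v" for v using that m0[of v] unfolding B_def by simp
      \<comment> \<open>The critical pair is an image \<open>r w\<close> that has received mass and
        a vertex \<open>v\<close> that still keeps some. Mass moves from the bottom up, so
        \<open>v\<close> is not strictly below \<open>w\<close>, and \<open>r w\<close>,
        \<open>w\<close>, \<open>v\<close> increase weakly.\<close>
      have mixed: "le (r w) v" if w: "w \<in> P" "moved t g w > 0" and v: "B v" for w v
      proof -
        have vP: "v \<in> P" using gD(3) BB[OF v] by blast
        show ?thesis
        proof (cases "le w v")
          case True
          then show ?thesis using le_trans[OF r(1) w(1) vP r(2)] w(1) by blast
        next
          case False
          then have vw: "le v w" "v \<noteq> w" using gD(5)[OF Aw[OF w(2)] BB[OF v]] le_refl[OF vP] by auto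
          \<comment> \<open>All mass weakly below \<open>v\<close> lies strictly below
            \<open>w\<close>, and less than \<open>t\<close> of it is there because \<open>w\<close>
            has begun to move. So \<open>v\<close> has been moved completely, against
            \<open>B v\<close>.\<close>
          have "g v + sum g {u \<in> P. le u v \<and> u \<noteq> v} = sum g (insert v {u \<in> P. le u v \<and> u \<noteq> v})"
            using fin by simp
          also have "\<dots> \<le> sum g {u \<in> P. le u w \<and> u \<noteq> w}"
          proof (rule sum_mono2[OF fin])
            show "insert v {u \<in> P. le u v \<and> u \<noteq> v} \<subseteq> {u \<in> P. le u w \<and> u \<noteq> w}"
              using vw vP w(1) le_trans[of _ v w] le_antisym[of v w] by auto
          qed (use gD(1) in blast)
          also have "\<dots> < t" using w(2) by (simp add: moved_def)
          finally have "moved t g v = g v" using gD(1)[of v] by (simp add: moved_def)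
          then show ?thesis using v by (simp add: B_def)
        qed
      qed
      show ?thesis
      proof (cases "A v"; cases "A v'")
        assume "A v" "A v'"
        then obtain w w' where w: "w \<in> P" "v = r w" "moved t g w > 0"
          and w': "w' \<in> P" "v' = r w'" "moved t g w' > 0" unfolding A_def by blast
        then show ?thesis using gD(5)[OF Aw[OF w(3)] Aw[OF w'(3)]] mono by blast
      next
        assume "A v" "\<not> A v'"
        then show ?thesis using AB[OF nz(2)] mixed unfolding A_def by blast
      next
        assume "\<not> A v" "A v'"
        then show ?thesis using AB[OF nz(1)] mixed unfolding A_def by blast
      next
        assume "\<not> A v" "\<not> A v'"
        then show ?thesis using AB nz gD(5) BB by blast
      qed
    qed
    ultimately show "?h z \<in> topspace realization" unfolding in_realization by blast
  qed
  fix g assume g: "g \<in> topspace realization"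
  note gD = realizationD[OF g]
  have sum0: "0 \<le> sum g {u \<in> P. le u w \<and> u \<noteq> w}" for w using gD(1) by (simp add: sum_nonneg)
  have "moved 0 g w = 0" for w using sum0[of w] by (simp add: moved_def)
  then show "?h (0, g) = id g" by simp
  have "moved 1 g w = g w" for w
  proof (cases "w \<in> P")
    case True
    have "g w + sum g {u \<in> P. le u w \<and> u \<noteq> w} = sum g (insert w {u \<in> P. le u w \<and> u \<noteq> w})"
      using fin by simp
    also have "\<dots> \<le> sum g P" using True gD(1) by (intro sum_mono2 finite_P) auto
    finally show ?thesis using gD(1)[of w] gD(4) by (simp add: moved_def)
  next
    case False
    then show ?thesis using gD(2)[OF False] by (simp add: moved_def)
  qed
  then show "?h (1, g) = push_forward r P g" by (simp add: push_forward_def fun_eq_iff)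
qed

lemma push_forward_nonzero:
  assumes "push_forward r P g v \<noteq> 0"
  obtains w where "w \<in> P" "r w = v" "g w \<noteq> 0"
proof -
  have "\<exists>w\<in>{w \<in> P. r w = v}. g w \<noteq> 0"
    using assms unfolding push_forward_def by (meson sum.neutral)
  then show thesis using that by blast
qed

text \<open>The identity is homotopic to \<open>push_forward r P\<close> because \<open>r\<close>
  descends, and the latter to a constant: every image of \<open>r\<close> is comparable to
  \<open>m\<close>, so straight segments to the vertex \<open>m\<close> stay in the
  realization.\<close>

lemma contractible_realization:
  assumes r: "\<And>v. v \<in> P \<Longrightarrow> r v \<in> P" "\<And>v. v \<in> P \<Longrightarrow> le (r v) v"
    and mono: "\<And>v w. \<lbrakk>v \<in> P; w \<in> P; le v w\<rbrakk> \<Longrightarrow> le (r v) (r w)"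
    and m: "m \<in> P" "\<And>v. v \<in> P \<Longrightarrow> le (r v) m"
  shows "contractible_space realization"
proof -
  define \<delta> where "\<delta> = (\<lambda>v. if v = m then 1 else 0 :: real)"
  note hom = homotopic_id_push_forward[of r, OF r mono]
  have "\<delta> \<in> topspace realization"
    unfolding in_realization \<delta>_def using m(1) finite_P le_refl[OF m(1)] by auto
  then have "homotopic_with (\<lambda>x. True) realization realization (push_forward r P) (\<lambda>x. \<delta>)"
  proof (intro homotopic_realization_linear finite_P)
    show "continuous_map realization realization (push_forward r P)"
      using homotopic_with_imp_continuous_maps[OF hom] by blast
    fix g v w assume "push_forward r P g v \<noteq> 0" "\<delta> w \<noteq> 0"
    then show "le v w \<or> le w v"
      using m(2) by (auto simp: \<delta>_def elim!: push_forward_nonzero split: if_splits)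
  qed simp
  then show ?thesis
    using homotopic_with_trans[OF hom] unfolding contractible_space_def by blast
qed

end

text \<open>The \<open>q + 2\<close> atoms are represented by their indices \<open>0, \<dots>, q + 1\<close>; \<open>J\<close> is the join of a set
  of atoms.\<close>

locale boolean_crosscut = finite_poset +
  fixes q :: nat and atoms :: "'a \<Rightarrow> nat set" and J :: "nat set \<Rightarrow> 'a"
  assumes atoms: "v \<in> P \<Longrightarrow> atoms v \<noteq> {}" "v \<in> P \<Longrightarrow> atoms v \<subset> {..Suc q}"
    and atoms_mono: "\<lbrakk>v \<in> P; w \<in> P; le v w\<rbrakk> \<Longrightarrow> atoms v \<subseteq> atoms w"
    and J: "\<lbrakk>S \<noteq> {}; S \<subset> {..Suc q}\<rbrakk> \<Longrightarrow> J S \<in> P" "\<lbrakk>S \<noteq> {}; S \<subset> {..Suc q}\<rbrakk> \<Longrightarrow> atoms (J S) = S"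
    and J_mono: "\<lbrakk>S \<noteq> {}; S \<subseteq> S'; S' \<subset> {..Suc q}\<rbrakk> \<Longrightarrow> le (J S) (J S')"
    and J_le: "v \<in> P \<Longrightarrow> le (J (atoms v)) v"
begin

text \<open>The linear extension of the map that sends a vertex \<open>v\<close> to the indicator
  vector of \<open>atoms v\<close>.\<close>

definition height :: "('a \<Rightarrow> real) \<Rightarrow> nat \<Rightarrow> real" where
  "height g i = sum g {v \<in> P. i \<in> atoms v}"

text \<open>Up to positive scaling, the \<open>q\<close>-sphere is the space of nonconstant real \<open>(q + 2)\<close>-tuples
  modulo constant ones. The quotient is realized by subtracting the last coordinate, so that
  coordinate \<open>q + 1\<close>, which is 0 on \<open>nsphere q\<close>, is an honest atom index below.\<close>

definition to_sphere :: "('a \<Rightarrow> real) \<Rightarrow> nat \<Rightarrow> real" where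
  "to_sphere g = normalize_sphere q (\<lambda>i. height g i - height g (Suc q))"

text \<open>Positive exactly if \<open>S\<close> is a superlevel set of \<open>y\<close>; superlevel sets form a chain.\<close>

definition weight :: "(nat \<Rightarrow> real) \<Rightarrow> nat set \<Rightarrow> real" where
  "weight y S = (\<Prod>i\<in>S. \<Prod>j\<in>{..Suc q} - S. max 0 (y i - y j))"

definition closed_elements :: "'a set" where
  "closed_elements = {v \<in> P. J (atoms v) = v}"

text \<open>Exact barycentric coordinates would be gaps between the sorted values of
  \<open>y\<close>. The normalized products have support in the same chain of superlevel sets, which
  is enough for a homotopy inverse, and their continuity is visible from the formula.\<close>

definition from_sphere :: "(nat \<Rightarrow> real) \<Rightarrow> 'a \<Rightarrow> real" where
  "from_sphere y v = (if v \<in> closed_elements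
     then weight y (atoms v) / (\<Sum>w\<in>closed_elements. weight y (atoms w)) else 0)"

lemma finite_closed: "finite closed_elements"
  using finite_P by (simp add: closed_elements_def)

lemma finite_atoms: "v \<in> P \<Longrightarrow> finite (atoms v)"
  using atoms(2) finite_subset[of "atoms v" "{..Suc q}"] by auto

text \<open>A support vertex with atom \<open>j\<close> is comparable to \<open>v\<close> but not
  below it, so it lies above \<open>v\<close> and has atom \<open>i\<close> as well. In addition
  \<open>v\<close> contributes its positive mass to the height of \<open>i\<close> only.\<close>

lemma height_less:
  assumes g: "g \<in> topspace realization" and v: "g v \<noteq> 0" and ij: "i \<in> atoms v" "j \<notin> atoms v"
  shows "height g j < height g i"
proof -
  note gD = realizationD[OF g]
  have vP: "v \<in> P" using gD(3)[OF v] .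
  have "height g j = sum g {w \<in> P. j \<in> atoms w \<and> g w \<noteq> 0}"
    unfolding height_def using finite_P by (intro sum.mono_neutral_right) auto
  also have "\<dots> \<le> sum g ({w \<in> P. i \<in> atoms w} - {v})"
  proof (rule sum_mono2)
    show "{w \<in> P. j \<in> atoms w \<and> g w \<noteq> 0} \<subseteq> {w \<in> P. i \<in> atoms w} - {v}"
    proof
      fix w assume "w \<in> {w \<in> P. j \<in> atoms w \<and> g w \<noteq> 0}"
      then have w: "w \<in> P" "j \<in> atoms w" "g w \<noteq> 0" by auto
      then have "le v w" using gD(5)[OF v w(3)] atoms_mono[OF w(1) vP] ij(2) by blast
      then show "w \<in> {w \<in> P. i \<in> atoms w} - {v}"
        using atoms_mono[OF vP w(1)] ij w by auto
    qed
  qed (use finite_P gD(1) in auto)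
  also have "\<dots> < g v + sum g ({w \<in> P. i \<in> atoms w} - {v})"
    using v gD(1)[of v] by simp
  also have "\<dots> = height g i"
    unfolding height_def using vP ij(1) finite_P by (intro sum.remove[symmetric]) auto
  finally show ?thesis .
qed

lemma atoms_cases:
  assumes "v \<in> P"
  obtains i j where "i \<in> atoms v" "j \<notin> atoms v" "i \<le> Suc q" "j \<le> Suc q"
  using atoms[OF assms] by blast

lemma height_nonconstant:
  assumes "g \<in> topspace realization"
  shows "\<exists>i\<le>q. height g i - height g (Suc q) \<noteq> 0"
proof -
  obtain v where v: "v \<in> P" "0 < g v" using realization_obtain[OF assms] .
  obtain i j where "i \<in> atoms v" "j \<notin> atoms v" "i \<le> Suc q" "j \<le> Suc q"
    using atoms_cases[OF v(1)] .
  moreover from this have "height g j < height g i" using height_less[OF assms, of v] v(2) by simp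
  ultimately show ?thesis
    by (metis diff_eq_eq add_0 le_SucE less_irrefl)
qed

lemma continuous_map_height:
  "continuous_map realization euclideanreal (\<lambda>g. height g i)"
  unfolding height_def using finite_P
  by (intro continuous_intros continuous_map_realization_proj) auto

lemma continuous_map_to_sphere: "continuous_map realization (nsphere q) to_sphere"
  unfolding to_sphere_def
  by (intro continuous_map_normalize_sphere continuous_intros continuous_map_height height_nonconstant)

lemma to_sphere_less:
  assumes g: "g \<in> topspace realization" and ij: "i \<le> Suc q" "j \<le> Suc q" "height g j < height g i"
  shows "to_sphere g j < to_sphere g i"
proof -
  let ?N = "sqrt (\<Sum>i\<le>q. (height g i - height g (Suc q))\<^sup>2)"
  have "0 < (\<Sum>i\<le>q. (height g i - height g (Suc q))\<^sup>2)"
    using height_nonconstant[OF g] sum_squares_pos[of _ q "\<lambda>i. height g i - height g (Suc q)"] by blast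
  then have "0 < ?N" by simp
  \<comment> \<open>At \<open>k = Suc q\<close> both sides vanish, so the last atom obeys the same
    formula as the others.\<close>
  moreover have "to_sphere g k = (height g k - height g (Suc q)) / ?N" if "k \<le> Suc q" for k
    using that by (cases "k = Suc q") (auto simp: to_sphere_def normalize_sphere_def)
  ultimately show ?thesis using ij by (simp add: divide_strict_right_mono)
qed

lemma weight_nonneg: "0 \<le> weight y S"
  unfolding weight_def by (intro prod_nonneg) auto

lemma weight_nonzero:
  assumes "finite S"
  shows "weight y S \<noteq> 0 \<longleftrightarrow> (\<forall>i\<in>S. \<forall>j\<in>{..Suc q} - S. y j < y i)"
proof -
  have "max 0 (y i - y j) \<noteq> 0 \<longleftrightarrow> y j < y i" for i j by (auto simp: max_def)
  then show ?thesis using assms by (simp add: weight_def)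
qed

lemma closed_chain:
  assumes v: "v \<in> closed_elements" "\<And>i j. \<lbrakk>i \<in> atoms v; j \<le> Suc q; j \<notin> atoms v\<rbrakk> \<Longrightarrow> (y :: nat \<Rightarrow> real) j < y i"
    and w: "w \<in> closed_elements" "\<And>i j. \<lbrakk>i \<in> atoms w; j \<le> Suc q; j \<notin> atoms w\<rbrakk> \<Longrightarrow> y j < y i"
  shows "le v w \<or> le w v"
proof -
  have P: "v \<in> P" "w \<in> P" "J (atoms v) = v" "J (atoms w) = w"
    using v(1) w(1) by (auto simp: closed_elements_def)
  have "atoms v \<subseteq> atoms w \<or> atoms w \<subseteq> atoms v"
  proof (rule ccontr)
    assume "\<not> ?thesis"
    then obtain i j where ij: "i \<in> atoms v" "i \<notin> atoms w" "j \<in> atoms w" "j \<notin> atoms v" by blast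
    then have "i \<le> Suc q" "j \<le> Suc q" using atoms(2)[OF P(1)] atoms(2)[OF P(2)] by auto
    then have "y j < y i" "y i < y j" using v(2) w(2) ij by blast+
    then show False by simp
  qed
  then show ?thesis using J_mono[OF atoms(1) _ atoms(2)] P by metis
qed

lemma total_weight_pos:
  assumes y: "y \<in> topspace (nsphere q)"
  shows "0 < (\<Sum>w\<in>closed_elements. weight y (atoms w))"
proof -
  \<comment> \<open>The maximizers of \<open>y\<close> form a superlevel set. It is proper:
    otherwise \<open>y\<close> would be constant, hence zero because coordinate \<open>Suc q\<close>
    is, and zero is not on the sphere.\<close>
  define S where "S = {i \<in> {..Suc q}. \<forall>j\<le>Suc q. y j \<le> y i}"
  have "\<exists>i\<le>q. y i \<noteq> 0"
  proof (rule ccontr)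
    assume "\<not> ?thesis"
    then have "(\<Sum>i\<le>q. (y i)\<^sup>2) = 0" by simp
    then show False using y by (simp add: topspace_nsphere_iff)
  qed
  then obtain i where i: "i \<le> q" "y i \<noteq> 0" by blast
  have last: "y (Suc q) = 0" using y by (simp add: topspace_nsphere_iff)
  have "\<exists>m\<in>{..Suc q}. \<forall>j\<in>{..Suc q}. y j \<le> y m"
    using Max_in[of "y ` {..Suc q}"] Max_ge[of "y ` {..Suc q}"] by fastforce
  then have ne: "S \<noteq> {}" by (auto simp: S_def)
  have "S \<subset> {..Suc q}"
  proof (rule ccontr)
    assume "\<not> ?thesis"
    then have "S = {..Suc q}" by (auto simp: S_def)
    then have "i \<in> S" "Suc q \<in> S" using i(1) by auto
    then have "y i \<le> y (Suc q)" "y (Suc q) \<le> y i" using i(1) unfolding S_def by auto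
    then show False using i last by simp
  qed
  note JS = J(1)[OF ne this] J(2)[OF ne this]
  have "y j < y i" if ij: "i \<in> S" "j \<in> {..Suc q} - S" for i j
  proof -
    obtain k where "k \<le> Suc q" "y j < y k" using ij(2) by (auto simp: S_def not_le)
    then show ?thesis using ij(1) unfolding S_def by force
  qed
  then have "weight y S \<noteq> 0" using weight_nonzero[of S y] by (simp add: S_def)
  then have "0 < weight y (atoms (J S))" using weight_nonneg[of y S] JS(2) by simp
  moreover have "J S \<in> closed_elements" using JS by (simp add: closed_elements_def)
  ultimately show ?thesis using weight_nonneg by (intro sum_pos2[OF finite_closed])
qed

lemma from_sphere_nonzero:
  assumes "from_sphere y v \<noteq> 0"
  shows "v \<in> closed_elements" "\<lbrakk>i \<in> atoms v; j \<le> Suc q; j \<notin> atoms v\<rbrakk> \<Longrightarrow> y j < y i"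
proof -
  show v: "v \<in> closed_elements" using assms by (auto simp: from_sphere_def split: if_splits)
  have "weight y (atoms v) \<noteq> 0" using assms v by (auto simp: from_sphere_def)
  then show "\<lbrakk>i \<in> atoms v; j \<le> Suc q; j \<notin> atoms v\<rbrakk> \<Longrightarrow> y j < y i"
    using weight_nonzero[OF finite_atoms, of v y] v by (auto simp: closed_elements_def)
qed

lemma from_sphere_in:
  assumes y: "y \<in> topspace (nsphere q)"
  shows "from_sphere y \<in> topspace realization"
proof -
  note pos = total_weight_pos[OF y]
  have "sum (from_sphere y) P = sum (from_sphere y) closed_elements"
    using finite_P by (intro sum.mono_neutral_right) (auto simp: closed_elements_def from_sphere_def)
  also have "\<dots> = (\<Sum>v\<in>closed_elements. weight y (atoms v) / (\<Sum>w\<in>closed_elements. weight y (atoms w)))"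
    by (simp add: from_sphere_def)
  also have "\<dots> = 1" using pos by (simp flip: sum_divide_distrib)
  finally have "sum (from_sphere y) P = 1" .
  moreover have "0 \<le> from_sphere y v" for v
    using weight_nonneg pos by (simp add: from_sphere_def)
  moreover have "from_sphere y v = 0" if "v \<notin> P" for v
    using that by (simp add: from_sphere_def closed_elements_def)
  moreover have "le v w \<or> le w v" if "from_sphere y v \<noteq> 0" "from_sphere y w \<noteq> 0" for v w
    using closed_chain[of v y w] from_sphere_nonzero[OF that(1)] from_sphere_nonzero[OF that(2)] by blast
  ultimately show ?thesis unfolding in_realization by blast
qed

lemma continuous_map_from_sphere: "continuous_map (nsphere q) realization from_sphere"
  unfolding continuous_map_realization_iff
proof (intro conjI allI funcsetI from_sphere_in)
  fix v
  have w: "continuous_map (nsphere q) euclideanreal (\<lambda>y. weight y (atoms w))" if "w \<in> P" for w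
    unfolding weight_def using finite_atoms[OF that]
    by (intro continuous_intros continuous_map_nsphere_projection) auto
  have "continuous_map (nsphere q) euclideanreal
      (\<lambda>y. weight y (atoms v) / (\<Sum>w\<in>closed_elements. weight y (atoms w)))" if "v \<in> closed_elements"
  proof (intro continuous_intros w finite_closed)
    show "v \<in> P" using that by (simp add: closed_elements_def)
    show "w \<in> P" if "w \<in> closed_elements" for w using that by (simp add: closed_elements_def)
    show "(\<Sum>w\<in>closed_elements. weight y (atoms w)) \<noteq> 0" if "y \<in> topspace (nsphere q)" for y
      using total_weight_pos[OF that] by simp
  qed
  then show "continuous_map (nsphere q) euclideanreal (\<lambda>y. from_sphere y v)"
    by (cases "v \<in> closed_elements") (simp_all add: from_sphere_def)
qed

text \<open>The support of \<open>g\<close> need not consist of joins, so \<open>g\<close> is pushed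
  along \<open>v\<close> to \<open>J (atoms v)\<close> before the segment is drawn. After that, both
  supports consist of closed elements whose atom sets are superlevel sets of
  \<open>to_sphere g\<close>, and these form a chain.\<close>

lemma homotopic_from_to_sphere:
  "homotopic_with (\<lambda>x. True) realization realization (from_sphere \<circ> to_sphere) id"
proof -
  define r where "r v = J (atoms v)" for v
  have r: "r v \<in> P" "le (r v) v" "atoms (r v) = atoms v" if "v \<in> P" for v
    using atoms[OF that] J J_le[OF that] by (auto simp: r_def)
  have mono: "le (r v) (r w)" if "v \<in> P" "w \<in> P" "le v w" for v w
    unfolding r_def using atoms that atoms_mono by (intro J_mono) auto
  note hom = homotopic_id_push_forward[of r, OF r(1,2) mono]
  have "homotopic_with (\<lambda>x. True) realization realization (push_forward r P) (from_sphere \<circ> to_sphere)"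
  proof (rule homotopic_realization_linear[OF finite_P])
    show "continuous_map realization realization (push_forward r P)"
      using homotopic_with_imp_continuous_maps[OF hom] by blast
    show "continuous_map realization realization (from_sphere \<circ> to_sphere)"
      using continuous_map_to_sphere continuous_map_from_sphere by (rule continuous_map_compose)
    fix g v w
    assume g: "g \<in> topspace realization" and v: "push_forward r P g v \<noteq> 0"
      and w: "(from_sphere \<circ> to_sphere) g w \<noteq> 0"
    obtain u where u: "u \<in> P" "r u = v" "g u \<noteq> 0" using push_forward_nonzero[OF v] .
    have av: "atoms v = atoms u" and "v \<in> P" using r(1,3)[OF u(1)] u(2) by auto
    have "v \<in> closed_elements" using u(2) \<open>v \<in> P\<close> av by (simp add: closed_elements_def r_def)
    moreover have "to_sphere g j < to_sphere g i" if "i \<in> atoms v" "j \<le> Suc q" "j \<notin> atoms v" for i j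
    proof (rule to_sphere_less[OF g _ that(2)])
      show "i \<le> Suc q" using atoms(2)[OF \<open>v \<in> P\<close>] that(1) by auto
      show "height g j < height g i" using height_less[OF g u(3)] that av by simp
    qed
    ultimately show "le v w \<or> le w v"
      using closed_chain[of v "to_sphere g" w] from_sphere_nonzero[of "to_sphere g" w] w by auto
  qed
  with hom have "homotopic_with (\<lambda>x. True) realization realization id (from_sphere \<circ> to_sphere)"
    by (rule homotopic_with_trans)
  then show ?thesis by (rule homotopic_with_symD)
qed

text \<open>A support vertex of \<open>from_sphere y\<close> supplies indices \<open>i\<close>,
  \<open>j\<close> that \<open>y\<close> and the heights order in the same strict way. Their linear
  interpolation is therefore never constant and can be normalized at all times.\<close>

lemma homotopic_to_from_sphere:
  "homotopic_with (\<lambda>x. True) (nsphere q) (nsphere q) (to_sphere \<circ> from_sphere) id"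
proof -
  define d where "d z i = (1 - fst z) * snd z i +
      fst z * (height (from_sphere (snd z)) i - height (from_sphere (snd z)) (Suc q))" for z :: "real \<times> (nat \<Rightarrow> real)" and i
  have "homotopic_with (\<lambda>x. True) (nsphere q) (nsphere q) id (to_sphere \<circ> from_sphere)"
  proof (rule homotopic_with_TrueI)
    let ?X = "prod_topology (top_of_set {0..1::real}) (nsphere q)"
    have h: "continuous_map (nsphere q) euclideanreal (\<lambda>y. height (from_sphere y) i)" for i
      using continuous_map_compose[OF continuous_map_from_sphere continuous_map_height[of i]]
      by (simp add: o_def)
    show "continuous_map ?X (nsphere q) (\<lambda>z. normalize_sphere q (d z))"
    proof (rule continuous_map_normalize_sphere)
      show "continuous_map ?X euclideanreal (\<lambda>z. d z i)" for i
        unfolding d_def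
        by (intro continuous_intros continuous_map_interval_fst continuous_map_interval_snd[OF h]
            continuous_map_interval_snd[OF continuous_map_nsphere_projection])
      fix z assume "z \<in> topspace ?X"
      then obtain t y where z: "z = (t, y)" "0 \<le> t" "t \<le> 1" "y \<in> topspace (nsphere q)" by auto
      let ?g = "from_sphere y"
      have g: "?g \<in> topspace realization" using from_sphere_in[OF z(4)] .
      obtain v where v: "v \<in> P" "0 < ?g v" using realization_obtain[OF g] .
      obtain i j where ij: "i \<in> atoms v" "j \<notin> atoms v" "i \<le> Suc q" "j \<le> Suc q"
        using atoms_cases[OF v(1)] .
      have "y j < y i" using from_sphere_nonzero(2)[of y v i j] v ij by simp
      moreover have "height ?g j < height ?g i" using height_less[OF g _ ij(1,2)] v(2) by simp
      moreover have "d z i - d z j = (1 - t) * (y i - y j) + t * (height ?g i - height ?g j)"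
        by (simp add: d_def z(1) algebra_simps)
      ultimately have "0 < d z i - d z j"
        using z(2,3) by (cases "t = 0") (auto intro!: add_nonneg_pos)
      moreover have "d z (Suc q) = 0" using z(4) by (simp add: d_def z(1) topspace_nsphere_iff)
      ultimately show "\<exists>i\<le>q. d z i \<noteq> 0"
        using ij(3,4) by (metis le_SucE diff_self less_irrefl)
    qed
    fix y assume "y \<in> topspace (nsphere q)"
    then show "normalize_sphere q (d (0, y)) = id y"
      using normalize_sphere_id by (simp add: d_def[abs_def])
    show "normalize_sphere q (d (1, y)) = (to_sphere \<circ> from_sphere) y"
      by (simp add: to_sphere_def d_def[abs_def])
  qed
  then show ?thesis by (simp add: homotopic_with_sym)
qed

lemma realization_homotopy_equivalent_sphere: "realization homotopy_equivalent_space nsphere q"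
  unfolding homotopy_equivalent_space_def
  using continuous_map_to_sphere continuous_map_from_sphere
    homotopic_from_to_sphere homotopic_to_from_sphere by blast

end

section \<open>Separating spheres from each other and from contractible spaces\<close>

lemma homotopy_equivalent_trivial_topology:
  "X homotopy_equivalent_space (trivial_topology :: 'b topology) \<longleftrightarrow> X = trivial_topology"
proof
  assume "X homotopy_equivalent_space (trivial_topology :: 'b topology)"
  then obtain f where "continuous_map X (trivial_topology :: 'b topology) f"
    by (auto simp: homotopy_equivalent_space_def)
  then show "X = trivial_topology" by simp
next
  assume "X = trivial_topology"
  then show "X homotopy_equivalent_space (trivial_topology :: 'b topology)"
    by (simp add: homeomorphic_imp_homotopy_equivalent_space homeomorphic_empty_space_eq)
qed

text \<open>Reduced homology in degree \<open>p\<close> is nontrivial on \<open>nsphere q\<close>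
  exactly for \<open>p = q\<close>.\<close>

lemma nsphere_homotopy_equivalent_iff:
  "nsphere p homotopy_equivalent_space nsphere q \<longleftrightarrow> p = q"
proof
  assume "nsphere p homotopy_equivalent_space nsphere q"
  then have "reduced_homology_group (int p) (nsphere p) \<cong> reduced_homology_group (int p) (nsphere q)"
    by (rule homotopy_equivalent_space_imp_isomorphic_reduced_homology_groups)
  then have "trivial_group (reduced_homology_group (int p) (nsphere p)) \<longleftrightarrow>
      trivial_group (reduced_homology_group (int p) (nsphere q))"
    by (intro isomorphic_group_triviality) auto
  then show "p = q" by (simp add: trivial_reduced_homology_group_nsphere)
qed (simp add: homotopy_equivalent_space_refl)

lemma sphere_space_homotopy_equivalent_iff:
  assumes "-1 \<le> d" "-1 \<le> e"
  shows "sphere_space d homotopy_equivalent_space sphere_space e \<longleftrightarrow> d = e"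
proof -
  have "\<not> trivial_topology homotopy_equivalent_space nsphere q" for q
    by (subst homotopy_equivalent_space_sym) (simp add: homotopy_equivalent_trivial_topology)
  then show ?thesis
    using assms
    by (auto simp: sphere_space_def homotopy_equivalent_trivial_topology nsphere_homotopy_equivalent_iff)
qed

text \<open>Nonemptiness settles dimension -1, because the empty space also counts as
  contractible.\<close>

lemma contractible_not_sphere:
  assumes "contractible_space X" "X \<noteq> trivial_topology"
  shows "\<not> X homotopy_equivalent_space sphere_space d"
  using assms non_contractible_space_nsphere homotopy_equivalent_space_contractibility
  by (auto simp: sphere_space_def homotopy_equivalent_trivial_topology)

section \<open>Intervals of the Tamari lattice\<close>

lemma order_complex_empty: "geometric_realization (order_complex R {}) = trivial_topology"
proof -
  have "order_complex R {} = {}" by (auto simp: order_complex_def)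
  then show ?thesis by (simp add: geometric_realization_def)
qed

locale tamari_interval =
  fixes n :: nat and s :: "nat \<Rightarrow> nat" and T Z :: ptree and ascents :: "(nat \<times> nat) list"
  assumes less: "tamari_less n s T Z"
    and dist: "distinct ascents"
    and set_ascents: "set ascents =
      {(a, b). tamari_ascent s T a b \<and> (b, a) \<in># tree_inv n s Z - tree_inv n s T}"
begin

abbreviation "I \<equiv> tree_inv n s T"
abbreviation "K \<equiv> tree_inv n s Z"
abbreviation "interval \<equiv> tamari_open_interval n s T Z"

text \<open>Atoms are positions in the list, which gives the index sets that
  \<open>boolean_crosscut\<close> expects. For \<open>W\<close> above \<open>T\<close>, the
  inequality says that \<open>W\<close> lies above the rotation along
  \<open>ascents ! i\<close>.\<close>

definition atoms_below :: "ptree \<Rightarrow> nat set" where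
  "atoms_below W = {i. i < length ascents \<and>
     (case ascents ! i of (a, b) \<Rightarrow> count I (b, a) < count (tree_inv n s W) (b, a))}"

definition join :: "nat set \<Rightarrow> (nat \<times> nat) multiset" where
  "join S = mis_join n s I ((!) ascents ` S)"

definition join_tree :: "nat set \<Rightarrow> ptree" where
  "join_tree S = (SOME W. tamari_tree n s W \<and> tree_inv n s W = join S)"

lemma trees: "tamari_tree n s T" "tamari_tree n s Z" "I \<subseteq># K" "I \<noteq> K"
  using less tree_inv_inj by (auto simp: tamari_less_def tamari_le_def)

lemma I: "tamari_mis n s I" and K: "tamari_mis n s K"
  using trees tamari_mis_tree_inv by auto

lemma in_ascents_iff:
  "(a, b) \<in> set ascents \<longleftrightarrow> mis_ascent n s I a b \<and> count I (b, a) < count K (b, a)"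
  by (simp add: set_ascents tamari_ascent_iff[OF trees(1)] in_diff_count)

lemma nth_ascents:
  assumes "i < length ascents" "ascents ! i = (a, b)"
  shows "mis_ascent n s I a b" "count I (b, a) < count K (b, a)"
  using nth_mem[OF assms(1)] assms(2) in_ascents_iff[of a b] by auto

lemma image_ascents:
  assumes "S \<subseteq> {..<length ascents}" "(a, b) \<in> (!) ascents ` S"
  shows "mis_ascent n s I a b"
proof -
  from assms(2) obtain i where i: "(a, b) = ascents ! i" "i \<in> S" ..
  from subsetD[OF assms(1) i(2)] have "i < length ascents" by (rule lessThan_iff[THEN iffD1])
  then show ?thesis using i(1)[symmetric] by (rule nth_ascents(1))
qed

lemma join_above: "S \<subseteq> {..<length ascents} \<Longrightarrow> join S \<in> mis_above n s I ((!) ascents ` S)"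
  unfolding join_def by (rule mis_join_in[OF I image_ascents])

lemma join_tree:
  assumes "S \<subseteq> {..<length ascents}"
  shows "tamari_tree n s (join_tree S)" "tree_inv n s (join_tree S) = join S"
proof -
  have "tamari_mis n s (join S)" using join_above[OF assms] by (simp add: mis_above_def)
  then have "\<exists>W. tamari_tree n s W \<and> tree_inv n s W = join S" using exists_tamari_tree by metis
  then have "tamari_tree n s (join_tree S) \<and> tree_inv n s (join_tree S) = join S"
    unfolding join_tree_def by (rule someI_ex)
  then show "tamari_tree n s (join_tree S)" "tree_inv n s (join_tree S) = join S" by auto
qed

lemma join_subset:
  assumes "S \<subseteq> atoms_below W" "tamari_tree n s W" "I \<subseteq># tree_inv n s W"
  shows "join S \<subseteq># tree_inv n s W"
  unfolding join_def
proof (rule mis_join_subset)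
  show "tree_inv n s W \<in> mis_above n s I ((!) ascents ` S)"
    using assms tamari_mis_tree_inv by (auto simp: mis_above_def atoms_below_def)
qed

lemma atoms_below_top: "atoms_below Z = {..<length ascents}"
  unfolding atoms_below_def
proof (intro equalityI subsetI CollectI conjI)
  fix i assume "i \<in> {..<length ascents}"
  then show "i < length ascents" by simp
  then show "case ascents ! i of (a, b) \<Rightarrow> count I (b, a) < count K (b, a)"
    using nth_ascents(2) by (simp split: prod.split)
qed simp

text \<open>This makes the poset of joins Boolean. By \<open>count_mis_join_notin\<close> a join
  raises no ascent outside its set, and distinctness of the list leads from the ascent back to its
  position.\<close>

lemma atoms_below_join:
  assumes S: "S \<subseteq> {..<length ascents}"
  shows "atoms_below (join_tree S) = S"
proof (intro equalityI subsetI)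
  fix i assume "i \<in> S"
  moreover have "ascents ! i \<in> (!) ascents ` S" using \<open>i \<in> S\<close> by simp
  ultimately show "i \<in> atoms_below (join_tree S)"
    using join_above[OF S] S join_tree(2)[OF S]
    by (cases "ascents ! i") (fastforce simp: atoms_below_def mis_above_def)
next
  fix i assume i: "i \<in> atoms_below (join_tree S)"
  obtain a b where ab: "ascents ! i = (a, b)" by fastforce
  have l: "i < length ascents" and less: "count I (b, a) < count (join S) (b, a)"
    using i join_tree(2)[OF S] ab by (auto simp: atoms_below_def)
  have "(a, b) \<in> (!) ascents ` S"
  proof (rule ccontr)
    assume "(a, b) \<notin> (!) ascents ` S"
    then have "count (join S) (b, a) = count I (b, a)"
      unfolding join_def using count_mis_join_notin[OF I image_ascents[OF S]] nth_ascents(1)[OF l ab]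
      by blast
    then show False using less by simp
  qed
  then obtain j where "j \<in> S" "ascents ! j = ascents ! i" using ab by auto
  then show "i \<in> S" using dist l S by (metis lessThan_iff nth_eq_iff_index_eq subsetD)
qed

lemma interval_iff:
  "W \<in> interval \<longleftrightarrow> tamari_tree n s W \<and> I \<subseteq># tree_inv n s W \<and> tree_inv n s W \<subseteq># K \<and> T \<noteq> W \<and> W \<noteq> Z"
  using trees by (auto simp: tamari_open_interval_def tamari_less_def tamari_le_def)

text \<open>An ascent at which \<open>W\<close> exceeds \<open>T\<close> is listed, because
  \<open>W\<close> lies below \<open>Z\<close> and so \<open>Z\<close> exceeds \<open>T\<close>
  there too.\<close>

lemma atoms_below_nonempty:
  assumes "tamari_tree n s W" "I \<subseteq># tree_inv n s W" "tree_inv n s W \<subseteq># K" "T \<noteq> W"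
  shows "atoms_below W \<noteq> {}"
proof -
  have "I \<noteq> tree_inv n s W" using assms tree_inv_inj[OF trees(1)] by blast
  then obtain a b where ab: "mis_ascent n s I a b" "count I (b, a) < count (tree_inv n s W) (b, a)"
    using exists_mis_ascent[OF I tamari_mis_tree_inv[OF assms(1)] assms(2)] by blast
  then have "count I (b, a) < count K (b, a)"
    using mset_subset_eq_count[OF assms(3), of "(b, a)"] by simp
  then have "(a, b) \<in> set ascents" using ab(1) in_ascents_iff by blast
  then obtain i where "i < length ascents" "ascents ! i = (a, b)" by (metis in_set_conv_nth)
  then show ?thesis using ab(2) by (auto simp: atoms_below_def)
qed

lemma atoms_below_interval:
  assumes "W \<in> interval"
  shows "atoms_below W \<noteq> {}" "atoms_below W \<subseteq> {..<length ascents}"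
  using assms atoms_below_nonempty[of W] by (auto simp: interval_iff atoms_below_def)

lemma ascents_nonempty: "ascents \<noteq> []"
proof -
  have "T \<noteq> Z" using less by (simp add: tamari_less_def)
  then have "atoms_below Z \<noteq> {}" using atoms_below_nonempty[OF trees(2,3)] by simp
  then show ?thesis unfolding atoms_below_top by auto
qed

lemma atoms_below_mono: "tamari_le n s V W \<Longrightarrow> atoms_below V \<subseteq> atoms_below W"
  unfolding atoms_below_def tamari_le_def
  by (auto split: prod.splits intro: less_le_trans mset_subset_eq_count)

lemma join_tree_interval:
  assumes "S \<noteq> {}" "S \<subseteq> {..<length ascents}" "join S \<noteq> K"
  shows "join_tree S \<in> interval"
  unfolding interval_iff
proof (intro conjI)
  show "tamari_tree n s (join_tree S)" by (rule join_tree[OF assms(2)])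
  show "I \<subseteq># tree_inv n s (join_tree S)"
    using join_above[OF assms(2)] join_tree(2)[OF assms(2)] by (simp add: mis_above_def)
  show "tree_inv n s (join_tree S) \<subseteq># K"
    using join_subset[of S Z] assms(2) trees join_tree(2)[OF assms(2)] atoms_below_top by simp
  have "atoms_below T = {}" by (auto simp: atoms_below_def)
  then show "T \<noteq> join_tree S" using atoms_below_join[OF assms(2)] assms(1) by auto
  show "join_tree S \<noteq> Z" using join_tree(2)[OF assms(2)] assms(3) by auto
qed

text \<open>A join over a proper index set misses some atom, whereas \<open>Z\<close> lies above all
  of them.\<close>

lemma join_ne_top:
  assumes "S \<subset> {..<length ascents}"
  shows "join S \<noteq> K"
proof
  assume "join S = K"
  have S: "S \<subseteq> {..<length ascents}" using assms by blast
  have "join_tree S = Z"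
    using tree_inv_inj[OF join_tree(1)[OF S] trees(2)] join_tree(2)[OF S] \<open>join S = K\<close> by simp
  then show False using atoms_below_join[OF S] atoms_below_top assms by auto
qed

lemma join_tree_mono:
  assumes "S \<subseteq> S'" "S' \<subseteq> {..<length ascents}"
  shows "tamari_le n s (join_tree S) (join_tree S')"
proof -
  have S: "S \<subseteq> {..<length ascents}" using assms by blast
  have "join S \<subseteq># join S'"
    unfolding join_def using assms
    by (intro mis_join_mono[OF I image_ascents[OF assms(2)]] image_mono) auto
  then show ?thesis
    using join_tree[OF S] join_tree[OF assms(2)] by (simp add: tamari_le_def)
qed

lemma join_tree_le:
  assumes "W \<in> interval"
  shows "tamari_le n s (join_tree (atoms_below W)) W"
  using assms join_subset[of "atoms_below W" W] join_tree[OF atoms_below_interval(2)[OF assms]]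
  by (auto simp: tamari_le_def interval_iff)

lemma finite_poset_interval: "finite_poset interval (tamari_le n s)"
proof
  show "finite interval"
    by (rule finite_subset[OF _ finite_tamari_trees[of n s]]) (auto simp: interval_iff)
  show "tamari_le n s V V" if "V \<in> interval" for V using that by (simp add: interval_iff tamari_le_def)
  show "V = W" if "tamari_le n s V W" "tamari_le n s W V" for V W
    using that tree_inv_inj by (auto simp: tamari_le_def intro: subset_mset.antisym)
  show "tamari_le n s U W" if "tamari_le n s U V" "tamari_le n s V W" for U V W
    using that by (auto simp: tamari_le_def intro: subset_mset.order_trans)
qed

sublocale finite_poset interval "tamari_le n s"
  by (rule finite_poset_interval)

lemma order_complex_sphere:
  assumes "join {..<length ascents} = K"
  shows "tamari_order_complex n s T Z homotopy_equivalent_space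
    sphere_space (int (length ascents) - 2)"
proof -
  \<comment> \<open>This is where the hypothesis enters: a tree of the interval above all atoms
    would lie above their join, which is \<open>Z\<close>.\<close>
  have proper: "atoms_below W \<subset> {..<length ascents}" if W: "W \<in> interval" for W
  proof -
    have "atoms_below W \<noteq> {..<length ascents}"
    proof
      assume "atoms_below W = {..<length ascents}"
      then have "K \<subseteq># tree_inv n s W"
        using join_subset[of "{..<length ascents}" W] W assms by (auto simp: interval_iff)
      then have "tree_inv n s W = K" using W by (auto simp: interval_iff intro: subset_mset.antisym)
      then show False using tree_inv_inj[OF _ trees(2)] W by (auto simp: interval_iff)
    qed
    then show ?thesis using atoms_below_interval(2)[OF W] by blast
  qed
  \<comment> \<open>One atom has no nonempty proper subsets, so the interval is empty and stands for
    the sphere of dimension -1. Otherwise \<open>q + 2\<close> atoms give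
    \<open>nsphere q\<close>.\<close>
  consider "length ascents = 1" | q where "length ascents = Suc (Suc q)"
    using ascents_nonempty by (metis One_nat_def length_0_conv not0_implies_Suc)
  then show ?thesis
  proof cases
    case 1
    have "interval = {}"
    proof (rule ccontr)
      assume "interval \<noteq> {}"
      then obtain W where "W \<in> interval" by blast
      from proper[OF this] atoms_below_interval[OF this] show False
        by (auto simp: 1 lessThan_Suc)
    qed
    then show ?thesis
      unfolding tamari_order_complex_def
      by (simp add: order_complex_empty 1 sphere_space_def homotopy_equivalent_space_refl
          homotopy_equivalent_trivial_topology)
  next
    case (2 q)
    have idx: "{..<length ascents} = {..Suc q}" by (simp add: 2 lessThan_Suc_atMost)
    interpret boolean_crosscut interval "tamari_le n s" q atoms_below join_tree
    proof
      show "atoms_below W \<noteq> {}" "atoms_below W \<subset> {..Suc q}" if "W \<in> interval" for W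
        using atoms_below_interval(1)[OF that] proper[OF that] idx by auto
      show "atoms_below V \<subseteq> atoms_below W" if "tamari_le n s V W" for V W
        using atoms_below_mono[OF that] .
      show "join_tree S \<in> interval" if "S \<noteq> {}" "S \<subset> {..Suc q}" for S
        using join_tree_interval[OF that(1)] join_ne_top[of S] that(2) idx by auto
      show "atoms_below (join_tree S) = S" if "S \<subset> {..Suc q}" for S
        using atoms_below_join[of S] that idx by auto
      show "tamari_le n s (join_tree S) (join_tree S')" if "S \<subseteq> S'" "S' \<subset> {..Suc q}" for S S'
        using join_tree_mono[of S S'] that idx by auto
      show "tamari_le n s (join_tree (atoms_below W)) W" if "W \<in> interval" for W
        using join_tree_le[OF that] .
    qed
    show ?thesis
      unfolding tamari_order_complex_def
      using realization_homotopy_equivalent_sphere by (simp add: sphere_space_def 2)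
  qed
qed

lemma order_complex_contractible:
  assumes "join {..<length ascents} \<noteq> K"
  shows "contractible_space (tamari_order_complex n s T Z)"
    and "tamari_order_complex n s T Z \<noteq> trivial_topology"
proof -
  let ?m = "join_tree {..<length ascents}"
  have ne: "{..<length ascents} \<noteq> {}" using ascents_nonempty by auto
  have m: "?m \<in> interval" using join_tree_interval[OF ne _ assms] by simp
  show "contractible_space (tamari_order_complex n s T Z)"
    unfolding tamari_order_complex_def
  proof (rule contractible_realization)
    fix W assume W: "W \<in> interval"
    note A = atoms_below_interval[OF W]
    show "join_tree (atoms_below W) \<in> interval"
    proof (rule join_tree_interval[OF A])
      show "join (atoms_below W) \<noteq> K"
        using join_ne_top[of "atoms_below W"] A(2) assms by (metis psubsetI)
    qed
    show "tamari_le n s (join_tree (atoms_below W)) W" using join_tree_le[OF W] .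
    show "tamari_le n s (join_tree (atoms_below W)) ?m" using join_tree_mono[OF A(2)] by simp
  next
    fix V W assume "W \<in> interval" "tamari_le n s V W"
    then show "tamari_le n s (join_tree (atoms_below V)) (join_tree (atoms_below W))"
      by (intro join_tree_mono atoms_below_mono atoms_below_interval(2))
  qed (rule m)
  have "(\<lambda>v. if v = ?m then 1 else 0) \<in> topspace (tamari_order_complex n s T Z)"
    unfolding tamari_order_complex_def in_realization using m finite_P le_refl[OF m] by auto
  then show "tamari_order_complex n s T Z \<noteq> trivial_topology" by auto
qed

lemma join_eq_trans_closure:
  "trans_closure n
     (foldl (\<lambda>I (a, b). capped_add s I (mset_set (tamari_added n s T a b))) I ascents) =
   join {..<length ascents}"
proof -
  have "foldl (\<lambda>I (a, b). capped_add s I (mset_set (tamari_added n s T a b))) I ascents =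
      foldl (\<lambda>I' (a, b). capped_add s I' (mset_set (mis_added I a b))) I ascents"
    by (rule foldl_cong) (auto simp: set_ascents tamari_added_eq[OF trees(1)])
  moreover have "(!) ascents ` {..<length ascents} = set ascents"
    by (auto simp: set_conv_nth)
  ultimately show ?thesis
    unfolding join_def using mis_join_eq_trans_closure[OF I dist] in_ascents_iff by simp
qed

end

theorem theorem4p16:
  fixes n :: nat and s :: "nat \<Rightarrow> nat" and T Z :: ptree and ascents :: "(nat \<times> nat) list"
  assumes "tamari_less n s T Z"
    and "distinct ascents"
    and "set ascents =
      {(a, b). tamari_ascent s T a b \<and> (b, a) \<in># tree_inv n s Z - tree_inv n s T}"
  shows "((\<exists>d\<ge>-1. tamari_order_complex n s T Z homotopy_equivalent_space sphere_space d) \<longleftrightarrow>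
       tree_inv n s Z =
         trans_closure n
           (foldl (\<lambda>I (a, b). capped_add s I (mset_set (tamari_added n s T a b)))
              (tree_inv n s T) ascents))
    \<and> (\<forall>d\<ge>-1. tamari_order_complex n s T Z homotopy_equivalent_space sphere_space d \<longrightarrow>
         d = int (length ascents) - 2)"
proof -
  interpret tamari_interval n s T Z ascents
    using assms by unfold_locales
  have l: "-1 \<le> int (length ascents) - 2" using ascents_nonempty by (cases ascents) auto
  show ?thesis
  proof (cases "join {..<length ascents} = K")
    case True
    note sphere = order_complex_sphere[OF True]
    have "d = int (length ascents) - 2"
      if "-1 \<le> d" "tamari_order_complex n s T Z homotopy_equivalent_space sphere_space d" for d
    proof -
      have "sphere_space d homotopy_equivalent_space sphere_space (int (length ascents) - 2)"
        using that(2) sphere homotopy_eqv_trans homotopy_equivalent_space_sym by blast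
      then show ?thesis using sphere_space_homotopy_equivalent_iff[OF that(1) l] by simp
    qed
    moreover have "\<exists>d\<ge>-1. tamari_order_complex n s T Z homotopy_equivalent_space sphere_space d"
      using sphere l by (intro exI[of _ "int (length ascents) - 2"] conjI)
    ultimately show ?thesis using True unfolding join_eq_trans_closure by simp
  next
    case False
    \<comment> \<open>No \<open>d\<close> qualifies in the contractible case, so the claim on the
      dimension holds vacuously.\<close>
    then show ?thesis
      using contractible_not_sphere[OF order_complex_contractible[OF False]]
      unfolding join_eq_trans_closure by auto
  qed
qed

end
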